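(* Let $\rho$ be a density operator of an optical mode with photon number operator $N$. Let $\Theta$ be a phase shift with uniform prior distribution on an interval $I$ of length $\ell_I$, applied to the probe state $\rho$ to give $\rho_\theta=e^{-iN\theta}\rho e^{iN\theta}$. Then for any estimate $\Theta_{\rm est}$ of $\Theta$ via a measurement on the phase-shifted probe state, the root-mean-square error satisfies $${\rm RMSE}=\langle(\Theta_{\rm est}-\Theta)^2\rangle^{1/2}\ \ge\ \frac{\ell_I}{2\pi}\,\frac{f_{\max}}{\langle N\rangle+\frac12},$$ where $\langle N\rangle=\mathrm{tr}[\rho N]$ and $f_{\max}\approx0.5823$ is the maximum value over $\alpha\ge\frac12$ of the function $f(\alpha)$ given in the context.
   Context: $N=\sum_{n\ge0}n|n\rangle\langle n|$ with $\{|n\rangle\}_{n=0,1,2,\dots}$ an orthonormal basis. The estimate is described by a POVM $\{M_{\theta_{\rm est}}\}$ on the unit circle, and the joint density of $\theta_{\rm est},\theta$ is $\ell_I^{-1}\mathrm{tr}[\rho_\theta M_{\theta_{\rm est}}]$ for $\theta\in I$ ($0<\ell_I\le2\pi$). In the RMSE the phase error $\theta_{\rm est}-\theta$ is taken in the reference interval $[-\pi,\pi)$ (reduced modulo $2\pi$). The function $f$ is $$f(\alpha)=\begin{cases}\dfrac{2}{\alpha}\left(\dfrac{\pi}{3\alpha-1}\right)^{1/2}\left(\dfrac{3\alpha-1}{2}\right)^{\frac1{1-\alpha}}\dfrac{(1-\alpha)^{1/2}\,\Gamma(\frac1{1-\alpha})}{\Gamma(\frac1{1-\alpha}-\frac12)},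 & \frac12\le\alpha\le1,\\[3mm]\dfrac{2}{\alpha}\left(\dfrac{\pi}{3\alpha-1}\right)^{1/2}\left(\dfrac{3\alpha-1}{2}\right)^{\frac1{1-\alpha}}\dfrac{(\alpha-1)^{1/2}\,\Gamma(\frac{\alpha}{\alpha-1}+\frac12)}{\Gamma(\frac{\alpha}{\alpha-1})}, & \alpha\ge1,\end{cases}$$ with $f(1)=\sqrt{2\pi/e^3}$ defined by the limit. *)

theory Defs
  imports "HOL-Analysis.Analysis"
begin

section \<open>Complex Hilbert spaces\<close>

text \<open>The sesquilinear product is conjugate-linear in its first argument (Dirac convention).
  Definiteness and the norm are inherited from \<^class>\<open>real_inner\<close>, since
  \<open>inner\<close> is the real part of \<open>cinner\<close>.\<close>

class complex_hilbert_space = real_inner + complete_space +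
  fixes scaleC :: "complex \<Rightarrow> 'a \<Rightarrow> 'a"  (infixr "*\<^sub>C" 75)
    and cinner :: "'a \<Rightarrow> 'a \<Rightarrow> complex"
  assumes scaleC_add_right: "a *\<^sub>C (x + y) = a *\<^sub>C x + a *\<^sub>C y"
    and scaleC_add_left: "(a + b) *\<^sub>C x = a *\<^sub>C x + b *\<^sub>C x"
    and scaleC_scaleC: "a *\<^sub>C (b *\<^sub>C x) = (a * b) *\<^sub>C x"
    and scaleR_scaleC: "r *\<^sub>R x = complex_of_real r *\<^sub>C x"
    and cinner_commute: "cinner x y = cnj (cinner y x)"
    and cinner_add_right: "cinner x (y + z) = cinner x y + cinner x z"
    and cinner_scaleC_right: "cinner x (a *\<^sub>C y) = a * cinner x y"
    and inner_cinner: "inner x y = Re (cinner x y)"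

definition orthonormal_basis :: "(nat \<Rightarrow> 'h::complex_hilbert_space) \<Rightarrow> bool" where
  "orthonormal_basis e \<longleftrightarrow>
     (\<forall>m n. cinner (e m) (e n) = (if m = n then 1 else 0)) \<and>
     (\<forall>x. (\<lambda>n. cinner (e n) x *\<^sub>C e n) sums x)"

definition bounded_operator :: "('h::complex_hilbert_space \<Rightarrow> 'h) \<Rightarrow> bool" where
  "bounded_operator A \<longleftrightarrow> bounded_linear A \<and> (\<forall>c x. A (c *\<^sub>C x) = c *\<^sub>C A x)"

definition positive_operator :: "('h::complex_hilbert_space \<Rightarrow> 'h) \<Rightarrow> bool" where
  "positive_operator A \<longleftrightarrow> bounded_operator A \<and> (\<forall>x. cinner x (A x) \<in> \<real>\<^sub>\<ge>\<^sub>0)"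

text \<open>For trace-class operators the trace does not depend on the orthonormal basis
  in which it is computed.\<close>

definition op_trace :: "(nat \<Rightarrow> 'h::complex_hilbert_space) \<Rightarrow> ('h \<Rightarrow> 'h) \<Rightarrow> complex" where
  "op_trace e A = (\<Sum>n. cinner (e n) (A (e n)))"

text \<open>Summability is stated explicitly because \<^const>\<open>suminf\<close> is
  unspecified on divergent series.\<close>

definition density_operator :: "(nat \<Rightarrow> 'h::complex_hilbert_space) \<Rightarrow> ('h \<Rightarrow> 'h) \<Rightarrow> bool" where
  "density_operator e \<rho> \<longleftrightarrow>
     positive_operator \<rho> \<and> summable (\<lambda>n. cinner (e n) (\<rho> (e n))) \<and> op_trace e \<rho> = 1"


section \<open>Photon number and phase shifts\<close>

text \<open>\<open>\<Sum>n. g n |n\<rangle>\<langle>n|\<close>, that is, \<open>g\<close> applied to the number operator.\<close>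

definition diagonal_op ::
    "(nat \<Rightarrow> 'h::complex_hilbert_space) \<Rightarrow> (nat \<Rightarrow> complex) \<Rightarrow> 'h \<Rightarrow> 'h" where
  "diagonal_op e g x = (\<Sum>n. g n *\<^sub>C (cinner (e n) x *\<^sub>C e n))"

text \<open>The number operator is unbounded, so its values are meaningful only on its domain,
  which contains every basis vector.\<close>

definition number_op :: "(nat \<Rightarrow> 'h::complex_hilbert_space) \<Rightarrow> 'h \<Rightarrow> 'h" where
  "number_op e = diagonal_op e of_nat"

text \<open>\<open>exp (- \<i> N \<theta>)\<close>\<close>

definition phase_op :: "(nat \<Rightarrow> 'h::complex_hilbert_space) \<Rightarrow> real \<Rightarrow> 'h \<Rightarrow> 'h" where
  "phase_op e \<theta> = diagonal_op e (\<lambda>n. exp (- \<i> * of_nat n * of_real \<theta>))"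

definition phase_shifted ::
    "(nat \<Rightarrow> 'h::complex_hilbert_space) \<Rightarrow> ('h \<Rightarrow> 'h) \<Rightarrow> real \<Rightarrow> 'h \<Rightarrow> 'h" where
  "phase_shifted e \<rho> \<theta> = phase_op e \<theta> \<circ> \<rho> \<circ> phase_op e (- \<theta>)"

text \<open>\<open>tr[\<rho> N]\<close>. The diagonal terms are nonnegative, and the trace takes the value
  \<open>\<infinity>\<close> for states with infinite mean photon number.\<close>

definition mean_number :: "(nat \<Rightarrow> 'h::complex_hilbert_space) \<Rightarrow> ('h \<Rightarrow> 'h) \<Rightarrow> ennreal" where
  "mean_number e \<rho> = (\<Sum>n. ennreal (Re (cinner (e n) (\<rho> (number_op e (e n))))))"


section \<open>Phase estimation\<close>

abbreviation circle :: "complex set" where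
  "circle \<equiv> sphere 0 1"

definition circle_sets :: "complex set set" where
  "circle_sets = sets (restrict_space borel circle)"

definition povm_on_circle :: "(complex set \<Rightarrow> 'h::complex_hilbert_space \<Rightarrow> 'h) \<Rightarrow> bool" where
  "povm_on_circle M \<longleftrightarrow>
     (\<forall>B\<in>circle_sets. positive_operator (M B)) \<and>
     M circle = id \<and>
     (\<forall>B :: nat \<Rightarrow> complex set. range B \<subseteq> circle_sets \<longrightarrow> disjoint_family B \<longrightarrow>
        (\<forall>x y. (\<lambda>i. cinner x (M (B i) y)) sums cinner x (M (\<Union>i. B i) y)))"

text \<open>Born rule: the law \<open>B \<mapsto> tr[\<sigma> M(B)]\<close> of the outcome in the state \<open>\<sigma>\<close>.\<close>

definition outcome_law ::
    "(nat \<Rightarrow> 'h::complex_hilbert_space) \<Rightarrow> ('h \<Rightarrow> 'h) \<Rightarrow>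
     (complex set \<Rightarrow> 'h \<Rightarrow> 'h) \<Rightarrow> complex measure" where
  "outcome_law e \<sigma> M =
     measure_of circle circle_sets (\<lambda>B. ennreal (Re (op_trace e (\<sigma> \<circ> M B))))"

text \<open>The representative modulo \<open>2 * pi\<close> in \<open>[-pi, pi)\<close>.\<close>

definition reduce_angle :: "real \<Rightarrow> real" where
  "reduce_angle t = t - 2 * pi * of_int \<lfloor>(t + pi) / (2 * pi)\<rfloor>"

text \<open>The joint law of the estimate and the phase has density \<open>tr[\<rho>\<^sub>\<theta> M(dz)] / L\<close> for \<open>\<theta> \<in> I\<close>,
  where \<open>z\<close> is the estimate as a point of the unit circle.\<close>

definition rmse ::
    "(nat \<Rightarrow> 'h::complex_hilbert_space) \<Rightarrow> ('h \<Rightarrow> 'h) \<Rightarrow>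
     (complex set \<Rightarrow> 'h \<Rightarrow> 'h) \<Rightarrow> real set \<Rightarrow> real \<Rightarrow> real" where
  "rmse e \<rho> M I L = sqrt (enn2real (
     (\<integral>\<^sup>+ \<theta>\<in>I. (\<integral>\<^sup>+ z. ennreal ((reduce_angle (Arg z - \<theta>))\<^sup>2)
                 \<partial>outcome_law e (phase_shifted e \<rho> \<theta>) M) \<partial>lborel) / ennreal L))"


section \<open>The constant\<close>

text \<open>Both \<open>\<alpha> < 1\<close> and \<open>\<alpha> > 1\<close> formulas extend continuously to \<open>\<alpha> = 1\<close> with the value given here.\<close>

definition f_renyi :: "real \<Rightarrow> real" where
  "f_renyi \<alpha> =
     (if \<alpha> = 1 then sqrt (2 * pi / exp 3)
      else 2 / \<alpha> * sqrt (pi / (3 * \<alpha> - 1)) * ((3 * \<alpha> - 1) / 2) powr (1 / (1 - \<alpha>)) *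
        (if \<alpha> < 1
         then sqrt (1 - \<alpha>) * Gamma (1 / (1 - \<alpha>)) / Gamma (1 / (1 - \<alpha>) - 1 / 2)
         else sqrt (\<alpha> - 1) * Gamma (\<alpha> / (\<alpha> - 1) + 1 / 2) / Gamma (\<alpha> / (\<alpha> - 1))))"

definition f_max :: real where
  "f_max = (SUP \<alpha>\<in>{1/2..}. f_renyi \<alpha>)"

end

theory Submission
  imports Defs
begin

text \<open>
  The bound on the error is proved directly, with a constant larger than \<^const>\<open>f_max\<close> and
  without entropies. A Cholesky factorisation writes \<open>\<rho>\<close> as a mixture of unnormalised pure states
  \<open>\<psi>\<close>. For a weight \<open>v \<ge> 0\<close> on the circle, positivity of the POVM gives
  \<open>E\<^bsub>\<psi>\<^esub>[v / (1 + v)] \<le> \<parallel>\<psi> - \<eta>\<parallel>\<^sup>2 + E\<^bsub>\<eta>\<^esub>[v]\<close> for every vector \<open>\<eta>\<close>. Let \<open>v\<close> be a bump of width about \<open>r\<close> around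
  the true phase, and let \<open>\<eta>\<close> have the amplitudes \<open>x n * \<langle>n|\<psi>\<rangle>\<close>, where \<open>x\<close> decreases linearly in \<open>n\<close>
  to zero. By Cauchy-Schwarz the law of \<open>\<eta>\<close> is dominated by that of a mixture of number states, which does not
  depend on the phase; averaging over \<open>I\<close> then only sees the integral of the bump. So the probability
  of an error below \<open>r\<close> is bounded by an affine function of the mean photon number, and the optimal
  \<open>r\<close> is proportional to \<open>L\<close> divided by the mean photon number plus one half.

  For \<^const>\<open>f_max\<close>, the value at \<open>\<alpha> = 3/4\<close> is \<open>125 / (96 * sqrt 5)\<close>, already within \<open>1/10000\<close> of the maximum. The
  quotient of Gamma functions is bounded above through its functional equation, and the logarithmic
  derivative of the resulting elementary function is bounded by rational functions.
\<close>

text \<open>All operators are handled through the basis \<open>e\<close>, in which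
  \<open>op_trace\<close> is defined. The Cholesky factors are triangular in it, so each
  \<open>\<rho> (e n)\<close> is a finite sum, and the trace needs only one interchange of a double
  series. With the weights \<open>s n = x n / (1 - x n) / u\<close>, where
  \<open>u = N + 1/2\<close>, the mass removed by the filter and the Cauchy-Schwarz factor of what
  it keeps combine to \<open>1 - x n\<close>. For a linear filter this is at most affine in
  \<open>n\<close>, so only the mean photon number enters. The summand 1/2 comes from evaluating the
  line at the midpoints \<open>n + 1/2\<close>: midpoint sums of a convex function stay below its
  integral. The constants: the bump has integral at most 18/5, the filter leaves a budget of 7/10,
  and the factor 5/4 turns this into 7/8 of \<open>r^2\<close>. The remaining 1/8 is the bound on
  the mean square error, and 2 * pi / (18/5 * sqrt 8), about 0.617, exceeds
  \<open>f_max\<close>.\<close>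

section \<open>The maximum of the Renyi function\<close>

lemma Gamma_real_plus1: "Gamma (x + 1) = x * Gamma x" if "x > 0" for x :: real
  using that by (intro Gamma_plus1) (auto simp: nonpos_Ints_def)

text \<open>Log-convexity of \<open>Gamma\<close> at the midpoint of \<open>x\<close> and
  \<open>x + 1\<close>, combined with the functional equation.\<close>

lemma Gamma_half_ratio_le:
  fixes x :: real
  assumes "x > 0"
  shows "(Gamma (x + 1/2) / Gamma x)\<^sup>2 \<le> x"
proof -
  have pos: "Gamma x > 0" "Gamma (x + 1/2) > 0" "Gamma (x + 1) > 0"
    using assms by auto
  have "(ln \<circ> Gamma) ((1 - 1/2) *\<^sub>R x + (1/2) *\<^sub>R (x + 1)) \<le> (1 - 1/2) * (ln \<circ> Gamma) x + (1/2) * (ln \<circ> Gamma) (x + 1)"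
    using assms by (intro convex_onD[OF log_convex_Gamma_real]) auto
  moreover have "(1 - 1/2) *\<^sub>R x + (1/2) *\<^sub>R (x + 1) = x + 1/2"
    by (simp add: field_simps)
  ultimately have "2 * ln (Gamma (x + 1/2)) \<le> ln (Gamma x) + ln (Gamma (x + 1))"
    by simp
  then have "ln ((Gamma (x + 1/2))\<^sup>2) \<le> ln (Gamma x * Gamma (x + 1))"
    using pos by (simp add: ln_mult ln_realpow)
  then have "(Gamma (x + 1/2))\<^sup>2 \<le> Gamma x * Gamma (x + 1)"
    using pos by simp
  also have "Gamma (x + 1) = x * Gamma x"
    using assms by (rule Gamma_real_plus1)
  finally show ?thesis
    using pos by (simp add: power_divide field_simps power2_eq_square)
qed

text \<open>The bound reproduces the leading terms \<open>x - 1/4 + 1/(32 x)\<close> of the squared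
  quotient at infinity. Divided by it, the squared quotient does not decrease from \<open>y\<close>
  to \<open>y + 1\<close>, while the crude bound keeps it below a sequence tending to 1 along
  \<open>x + n\<close>; so it is at most 1 already at \<open>x\<close>.\<close>

lemma Gamma_half_ratio_sharp:
  fixes x :: real
  assumes "x > 1/4"
  shows "(Gamma (x + 1/2) / Gamma x)\<^sup>2 \<le> (x - 1/4) + 1 / (32 * (x - 1/4))"
proof -
  define \<phi> :: "real \<Rightarrow> real" where "\<phi> = (\<lambda>x. (x - 1/4) + 1 / (32 * (x - 1/4)))"
  define q where "q = (\<lambda>x::real. (Gamma (x + 1/2) / Gamma x)\<^sup>2 / \<phi> x)"
  have \<phi>_gt: "\<phi> y > y - 1/4" if "y > 1/4" for y
    using that by (simp add: \<phi>_def)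
  have step: "q y \<le> q (y + 1)" if y: "y > 1/4" for y
  proof -
    have pos: "\<phi> y > 0" "\<phi> (y + 1) > 0"
      using \<phi>_gt[of y] \<phi>_gt[of "y + 1"] y by auto
    have G: "Gamma (y + 1 + 1/2) = (y + 1/2) * Gamma (y + 1/2)" "Gamma (y + 1) = y * Gamma y"
      using y Gamma_real_plus1[of "y + 1/2"] Gamma_real_plus1[of y]
      by (auto simp: add_ac)
    have "\<phi> y * (y + 1/2)\<^sup>2 - \<phi> (y + 1) * y\<^sup>2 = (9/16) / (32 * (y - 1/4) * (y + 3/4))"
      using y unfolding \<phi>_def by (simp add: divide_simps) algebra
    also have "\<dots> \<ge> 0" using y by simp
    finally have *: "\<phi> (y + 1) * y\<^sup>2 \<le> \<phi> y * (y + 1/2)\<^sup>2" by simp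
    have "q (y + 1) = (Gamma (y + 1/2) / Gamma y)\<^sup>2 * ((y + 1/2)\<^sup>2 / (y\<^sup>2 * \<phi> (y + 1)))"
      unfolding q_def G by (simp add: power_divide power_mult_distrib mult_ac)
    also have "\<dots> \<ge> (Gamma (y + 1/2) / Gamma y)\<^sup>2 * (1 / \<phi> y)"
      using pos y * by (intro mult_left_mono) (auto simp: field_simps)
    finally show ?thesis by (simp add: q_def)
  qed
  have chain: "q x \<le> q (x + real n)" for n
  proof (induction n)
    case (Suc n)
    then show ?case using step[of "x + real n"] assms by (simp add: add_ac)
  qed simp
  have upper: "q y \<le> y / (y - 1/4)" if "y > 1/4" for y
    using that \<phi>_gt[of y] Gamma_half_ratio_le[of y] unfolding q_def
    by (intro frac_le) auto
  have "(\<lambda>n. (x + real n) / (x + real n - 1/4)) \<longlonglongrightarrow> 1"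
  proof -
    have "filterlim (\<lambda>n. (x - 1/4) + real n) at_infinity sequentially"
      by (intro filterlim_at_top_imp_at_infinity filterlim_tendsto_add_at_top[OF tendsto_const]
          filterlim_real_sequentially)
    then have "(\<lambda>n. 1 + (1/4) / ((x - 1/4) + real n)) \<longlonglongrightarrow> 1 + 0"
      by (intro tendsto_add tendsto_const tendsto_divide_0[OF tendsto_const])
    moreover have "1 + (1/4) / ((x - 1/4) + real n) = (x + real n) / (x + real n - 1/4)" for n
      using assms by (simp add: field_simps)
    ultimately show ?thesis by simp
  qed
  moreover have "q x \<le> (x + real n) / (x + real n - 1/4)" for n
    using chain[of n] upper[of "x + real n"] assms by linarith
  ultimately have "q x \<le> 1"
    by (intro LIMSEQ_le_const) auto
  then have "(Gamma (x + 1/2) / Gamma x)\<^sup>2 \<le> \<phi> x"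
    using \<phi>_gt[OF assms] assms pos_divide_le_eq[of "\<phi> x" "(Gamma (x + 1/2) / Gamma x)\<^sup>2" 1]
    unfolding q_def by auto
  then show ?thesis by (simp only: \<phi>_def)
qed

text \<open>The logarithm is 2 artanh u. Two terms of the odd series give the lower bound;
  majorising the remaining terms by a geometric series in \<open>u^2\<close> gives the upper
  one.\<close>

lemma ln_artanh_bounds:
  fixes u :: real
  assumes "0 < u" "u < 1"
  shows "2 * (u + u^3/3) \<le> ln ((1 + u) / (1 - u))"
    and "ln ((1 + u) / (1 - u)) \<le> 2 * (u + u^3/3 + u^5 / (5 * (1 - u\<^sup>2)))"
proof -
  define x where "x = (1 + u) / (1 - u)"
  have x: "x > 1" using assms by (simp add: x_def field_simps)
  have "x - 1 = 2 * u / (1 - u)" "x + 1 = 2 / (1 - u)"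
    using assms by (simp_all add: x_def field_simps)
  then have y: "(x - 1) / (x + 1) = u" using assms by simp
  have "u\<^sup>2 < 1" using assms by (simp add: power_less_one_iff)
  then show "2 * (u + u^3/3) \<le> ln ((1 + u) / (1 - u))"
    "ln ((1 + u) / (1 - u)) \<le> 2 * (u + u^3/3 + u^5 / (5 * (1 - u\<^sup>2)))"
    using ln_approx_bounds[OF x, of 2, unfolded y] unfolding x_def[symmetric]
    by (simp_all add: eval_nat_numeral field_simps)
qed

corollary ln_artanh_ge:
  fixes u :: real
  assumes "0 < u" "u < 1"
  shows "2 * u \<le> ln ((1 + u) / (1 - u))"
proof -
  have "2 * u \<le> 2 * (u + u^3/3)" using assms by simp
  then show ?thesis using ln_artanh_bounds(1)[OF assms] by (rule order_trans)
qed

text \<open>With \<open>\<alpha> = 1 - 1/t\<close>, \<open>4 * pi * exp (renyi_log t)\<close> is \<open>(f_renyi \<alpha>)\<^sup>2\<close> with the quotient of Gamma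
  functions replaced by its sharp upper bound.\<close>

definition renyi_log :: "real \<Rightarrow> real" where
  "renyi_log t = 2 * ln t - 2 * ln (t - 1) - ln (2 * t - 3) + 2 * t * (ln (2 * t - 3) - ln (2 * t))
     + ln ((t - 3/4) + 1 / (32 * (t - 3/4)))"

section \<open>The range 1/2 <= \<alpha> < 1 in the variable t = 1 / (1 - \<alpha>)\<close>

lemma f_renyi_lt_1:
  assumes "t \<ge> 2"
  shows "f_renyi (1 - 1/t) = 2 * sqrt pi * t / (t - 1) / sqrt (2 * t - 3) *
     ((2 * t - 3) / (2 * t)) powr t * (Gamma t / Gamma (t - 1/2))"
proof -
  define \<alpha> where "\<alpha> = 1 - 1/t"
  have \<alpha>: "\<alpha> < 1" "1 - \<alpha> = 1 / t" "1 / (1 - \<alpha>) = t" "2 / \<alpha> = 2 * t / (t - 1)"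
    "(3 * \<alpha> - 1) / 2 = (2 * t - 3) / (2 * t)" "3 * \<alpha> - 1 = (2 * t - 3) / t"
    using assms by (simp_all add: \<alpha>_def field_simps)
  have s: "sqrt (pi / ((2 * t - 3) / t)) * sqrt (1 / t) = sqrt pi / sqrt (2 * t - 3)"
    using assms by (simp add: real_sqrt_mult[symmetric] real_sqrt_divide[symmetric] field_simps)
  have "f_renyi \<alpha> = 2 * t / (t - 1) * (sqrt (pi / ((2 * t - 3) / t)) * sqrt (1 / t)) *
     ((2 * t - 3) / (2 * t)) powr t * (Gamma t / Gamma (t - 1/2))"
    using \<alpha>(1) unfolding f_renyi_def \<alpha>(2-) by (simp only: if_True if_False less_irrefl mult.assoc times_divide_eq_right) (auto simp: mult_ac)
  then show ?thesis unfolding s \<alpha>_def[symmetric] by simp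
qed

lemma exp_renyi_log:
  assumes "t \<ge> 2"
  shows "exp (renyi_log t) = t\<^sup>2 / (t - 1)\<^sup>2 / (2 * t - 3) * ((2 * t - 3) / (2 * t)) powr (2 * t)
    * ((t - 3/4) + 1 / (32 * (t - 3/4)))"
proof -
  have "(t - 3/4) + 1 / (32 * (t - 3/4)) > 0" using assms by (intro add_pos_pos) auto
  moreover have "exp (2 * ln t) = t\<^sup>2" "exp (2 * ln (t - 1)) = (t - 1)\<^sup>2"
    using assms by (simp_all add: exp_double)
  ultimately show ?thesis
    unfolding renyi_log_def using assms by (simp add: exp_add exp_diff powr_def ln_div)
qed

lemma f_renyi_sq_le:
  assumes "t \<ge> 2"
  shows "f_renyi (1 - 1/t) \<ge> 0" "(f_renyi (1 - 1/t))\<^sup>2 \<le> 4 * pi * exp (renyi_log t)"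
proof -
  let ?\<phi> = "(t - 3/4) + 1 / (32 * (t - 3/4))"
  have \<phi>: "?\<phi> > 0" using assms by (intro add_pos_pos) auto
  have G: "(Gamma t / Gamma (t - 1/2))\<^sup>2 \<le> ?\<phi>"
    using Gamma_half_ratio_sharp[of "t - 1/2"] assms by (simp add: algebra_simps)
  show "f_renyi (1 - 1/t) \<ge> 0"
    unfolding f_renyi_lt_1[OF assms] using assms by (intro mult_nonneg_nonneg divide_nonneg_nonneg less_imp_le[OF Gamma_real_pos]) auto
  have p: "(((2 * t - 3) / (2 * t)) powr t)\<^sup>2 = ((2 * t - 3) / (2 * t)) powr (2 * t)"
    by (simp add: power2_eq_square powr_add[symmetric])
  have "(f_renyi (1 - 1/t))\<^sup>2 = 4 * pi * (t\<^sup>2 / (t - 1)\<^sup>2 / (2 * t - 3)) *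
      ((2 * t - 3) / (2 * t)) powr (2 * t) * (Gamma t / Gamma (t - 1/2))\<^sup>2"
    unfolding f_renyi_lt_1[OF assms] power_mult_distrib p using assms
    by (simp add: power_divide power_mult_distrib)
  also have "\<dots> \<le> 4 * pi * (t\<^sup>2 / (t - 1)\<^sup>2 / (2 * t - 3)) *
      ((2 * t - 3) / (2 * t)) powr (2 * t) * ?\<phi>"
    using assms G by (intro mult_left_mono) auto
  finally show "(f_renyi (1 - 1/t))\<^sup>2 \<le> 4 * pi * exp (renyi_log t)"
    unfolding exp_renyi_log[OF assms] by (simp add: mult_ac)
qed

definition renyi_slope :: "real \<Rightarrow> real" where
  "renyi_slope t = 2 * (ln (2 * t - 3) - ln (2 * t)) + 4 / (2 * t - 3) - 2 / (t * (t - 1))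
     + (32 * (t - 3/4)\<^sup>2 - 1) / ((t - 3/4) * (32 * (t - 3/4)\<^sup>2 + 1))"

lemma DERIV_renyi_log:
  assumes "t \<ge> 2"
  shows "(renyi_log has_real_derivative renyi_slope t) (at t)"
proof -
  have \<phi>: "(t - 3/4) + 1 / (32 * (t - 3/4)) > 0" using assms by (intro add_pos_pos) auto
  have w: "(32 * (t - 3/4)\<^sup>2 + 1) > 0" by (intro add_nonneg_pos) auto
  have 1: "(1 - 32 / (32 * (t - 3/4))\<^sup>2) / ((t - 3/4) + 1 / (32 * (t - 3/4))) 
    = (32 * (t - 3/4)\<^sup>2 - 1) / ((t - 3/4) * (32 * (t - 3/4)\<^sup>2 + 1))"
  proof -
    define w where "w = t - 3/4"
    have "w > 0" "32 * w\<^sup>2 + 1 > 0" using assms w by (auto simp: w_def)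
    moreover have "w + 1 / (32 * w) = (32 * w\<^sup>2 + 1) / (32 * w)"
      using \<open>w > 0\<close> by (simp add: field_simps power2_eq_square)
    moreover have "1 - 32 / (32 * w)\<^sup>2 = (32 * w\<^sup>2 - 1) / (32 * w\<^sup>2)"
      using \<open>w > 0\<close> by (simp add: field_simps power2_eq_square)
    moreover have "(a / (32 * w\<^sup>2)) / (b / (32 * w)) = a / (w * b)" for a b
      using \<open>w > 0\<close> by (cases "b = 0") (simp_all add: field_simps power2_eq_square)
    ultimately show ?thesis unfolding w_def[symmetric] by simp
  qed
  have 2: "2 * (1 / t) - 2 * (1 / (t - 1)) = - (2 / (t * (t - 1)))"
    using assms by (simp add: field_simps)
  have 3: "2 * t * (2 / (2 * t - 3)) - 2 / (2 * t - 3) - 2 = 4 / (2 * t - 3)"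
  proof -
    have "2 * t - 3 \<noteq> 0" using assms by auto
    then show ?thesis by (simp add: divide_simps)
  qed
  have 4: "2 * t * (2 / (2 * t)) = 2" using assms by simp
  have "(renyi_log has_real_derivative
     2 * (1 / t) - 2 * (1 / (t - 1)) - 2 / (2 * t - 3)
      + (2 * (ln (2 * t - 3) - ln (2 * t)) + 2 * t * (2 / (2 * t - 3) - 2 / (2 * t)))
      + (1 - 32 / (32 * (t - 3/4))\<^sup>2) / ((t - 3/4) + 1 / (32 * (t - 3/4)))) (at t)"
    unfolding renyi_log_def[abs_def]
    by (rule derivative_eq_intros refl | use assms \<phi> in \<open>simp add: power2_eq_square\<close>)+
  then show ?thesis
    by (rule DERIV_cong) (use 1 2 3 4 in \<open>unfold renyi_slope_def right_diff_distrib, linarith\<close>)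
qed


text \<open>With \<open>w = t - 3/4\<close> the logarithms have the arguments
  \<open>2 * w + 3/2\<close> and \<open>2 * w - 3/2\<close>. This symmetry makes their difference an
  artanh series in \<open>3 / (4 * w)\<close>, and the Gamma bound is centred at the same
  \<open>w\<close>.\<close>

lemma renyi_slope_artanh:
  assumes "w > 3/4"
  shows "renyi_slope (w + 3/4) = - 2 * ln ((1 + 3/(4*w)) / (1 - 3/(4*w)))
    + (8 / (4*w - 3) - 32 / ((4*w + 3) * (4*w - 1)) + (32 * w\<^sup>2 - 1) / (w * (32 * w\<^sup>2 + 1)))"
proof -
  have "1 + 3/(4*w) = (2 * (w + 3/4)) / (2 * w)" "1 - 3/(4*w) = (2 * (w + 3/4) - 3) / (2 * w)"
    using assms by (simp_all add: field_simps)
  then have "(1 + 3/(4*w)) / (1 - 3/(4*w)) = (2 * (w + 3/4)) / (2 * (w + 3/4) - 3)"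
    using assms by simp
  then have "ln ((1 + 3/(4*w)) / (1 - 3/(4*w))) = ln (2 * (w + 3/4)) - ln (2 * (w + 3/4) - 3)"
    using assms by (simp add: ln_div)
  moreover have "4 / (2 * (w + 3/4) - 3) = 8 / (4*w - 3)"
  proof -
    have "2 * (w + 3/4) - 3 = (4 * w - 3) / 2" by (simp add: field_simps)
    then show ?thesis by (simp only: divide_divide_eq_right)
  qed
  moreover have "2 / ((w + 3/4) * (w + 3/4 - 1)) = 32 / ((4*w + 3) * (4*w - 1))"
  proof -
    have "(4*w + 3) * (4*w - 1) = 16 * ((w + 3/4) * (w + 3/4 - 1))" by algebra
    then show ?thesis by simp
  qed
  ultimately show ?thesis
    unfolding renyi_slope_def by (simp add: algebra_simps)
qed

text \<open>The left-hand side is the slope with the logarithm replaced by two terms of its series in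
  \<open>3 / (4 * w)\<close>; in the applications \<open>a\<close>, \<open>b\<close>, \<open>c\<close>, \<open>d\<close>, \<open>e\<close> are polynomials in \<open>w = t - 3/4\<close>.\<close>

lemma slope_common_denominator:
  fixes w a b c d e :: real
  assumes "w > 0" "a > 0" "b > 0" "c > 0" "d > 0"
  shows "- 2 * (2 * (3/(4*w) + (3/(4*w))^3/3)) + (8 / a - 32 / (b * c) + e / (w * d))
    = (- (48 * w^2 + 9) * a * b * c * d + 128 * w^3 * b * c * d - 512 * w^3 * a * d + 16 * w^2 * e * a * b * c)
      / (16 * w^3 * a * b * c * d)"
proof -
  have "- 2 * (2 * (3/(4*w) + (3/(4*w))^3/3)) = - (48 * w^2 + 9) / (16 * w^3)"
    using assms by (simp add: field_simps eval_nat_numeral)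
  moreover have "8 / a = 128 * w^3 * b * c * d / (16 * w^3 * a * b * c * d)"
    "32 / (b * c) = 512 * w^3 * a * d / (16 * w^3 * a * b * c * d)"
    "e / (w * d) = 16 * w^2 * e * a * b * c / (16 * w^3 * a * b * c * d)"
    "- (48 * w^2 + 9) / (16 * w^3) = - (48 * w^2 + 9) * a * b * c * d / (16 * w^3 * a * b * c * d)"
    using assms by (simp_all add: eval_nat_numeral)
  ultimately show ?thesis
    by (simp only: add_divide_distrib diff_divide_distrib add_diff_eq add.assoc)
qed

lemma renyi_slope_le_0:
  assumes "t \<ge> 4"
  shows "renyi_slope t \<le> 0"
proof -
  define w where "w = t - 3/4"
  \<comment> \<open>\<open>s = t - 4\<close>. Recentred there, the polynomial in the numerator has
    only positive coefficients.\<close>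
  define s where "s = w - 13/4"
  have w: "w \<ge> 13/4" and s: "s \<ge> 0" and t: "t = w + 3/4" and ws: "w = s + 13/4"
    using assms by (auto simp: w_def s_def)
  have u: "0 < 3/(4*w)" "3/(4*w) < 1" using w by (auto simp: field_simps)
  have pos: "4*w - 3 > 0" "4*w + 3 > 0" "4*w - 1 > 0" "32 * w\<^sup>2 + 1 > 0" "w > 0"
    using w by (auto intro: add_nonneg_pos)
  have "renyi_slope t \<le> - 2 * (2 * (3/(4*w) + (3/(4*w))^3/3))
     + (8 / (4*w - 3) - 32 / ((4*w + 3) * (4*w - 1)) + (32 * w\<^sup>2 - 1) / (w * (32 * w\<^sup>2 + 1)))"
    using ln_artanh_bounds(1)[OF u] unfolding t by (subst renyi_slope_artanh) (use w in auto)
  also have "\<dots> = - (90288 + 6172960 * s + 9305408 * s^2 + 5670976 * s^3 + 1735168 * s^4 + 266240 * s^5 + 16384 * s^6)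
      / (16 * w^3 * (4*w - 3) * (4*w + 3) * (4*w - 1) * (32 * w\<^sup>2 + 1))"
    (is "_ = - ?P / ?D")
  proof -
    have "- (48 * w^2 + 9) * (4*w - 3) * (4*w + 3) * (4*w - 1) * (32 * w\<^sup>2 + 1)
        + 128 * w^3 * (4*w + 3) * (4*w - 1) * (32 * w\<^sup>2 + 1) - 512 * w^3 * (4*w - 3) * (32 * w\<^sup>2 + 1)
        + 16 * w^2 * (32 * w\<^sup>2 - 1) * (4*w - 3) * (4*w + 3) * (4*w - 1) = - ?P"
      unfolding ws by algebra
    then show ?thesis using pos by (subst slope_common_denominator) simp_all
  qed
  also have "?P \<ge> 0"
    using s by (intro add_nonneg_nonneg) auto
  then have "- ?P / ?D \<le> 0"
    using pos by (intro divide_nonpos_nonneg) auto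
  finally show ?thesis .
qed


text \<open>The logarithm enters with a negative sign, so the upper artanh bound is used; its tail
  gives the term with \<open>243 = 3^5\<close>. The resulting rational bound changes sign between t
  = 79/20 and t = 4, which is why the interval in between is treated separately.\<close>

lemma renyi_slope_ge:
  assumes "w > 3/4"
  shows "renyi_slope (w + 3/4) \<ge>
     (- 162 + 648 * w - 7344 * w^2 + 35136 * w^3 - 23040 * w^4 + 266240 * w^5 - 81920 * w^6)
      / (80 * w^3 * (4*w - 3) * (4*w + 3) * (4*w - 1) * (32 * w\<^sup>2 + 1))"
proof -
  define a b c d where "a = 4*w - 3" and "b = 4*w + 3" and "c = 4*w - 1" and "d = 32 * w\<^sup>2 + 1"
  have pos: "w > 0" "a > 0" "b > 0" "c > 0" "d > 0"
    using assms by (auto simp: a_def b_def c_def d_def intro: add_nonneg_pos)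
  have u: "0 < 3/(4*w)" "3/(4*w) < 1" using assms by (auto simp: field_simps)
  have "1 - (3/(4*w))\<^sup>2 = (a * b) / (16 * w^2)"
    using pos by (simp add: a_def b_def field_simps power2_eq_square)
  then have u5: "(3/(4*w))^5 / (5 * (1 - (3/(4*w))\<^sup>2)) = 243 / (320 * w^3 * a * b)"
    using pos by (simp add: power_divide) (simp add: eval_nat_numeral)
  have "renyi_slope (w + 3/4) = - 2 * ln ((1 + 3/(4*w)) / (1 - 3/(4*w)))
    + (8 / a - 32 / (b * c) + (32 * w\<^sup>2 - 1) / (w * d))"
    unfolding renyi_slope_artanh[OF assms] a_def b_def c_def d_def ..
  then have "renyi_slope (w + 3/4) \<ge> - 2 * (2 * (3/(4*w) + (3/(4*w))^3/3 + 243 / (320 * w^3 * a * b)))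
     + (8 / a - 32 / (b * c) + (32 * w\<^sup>2 - 1) / (w * d))"
    using ln_artanh_bounds(2)[OF u, unfolded u5] by linarith
  also have "- 2 * (2 * (3/(4*w) + (3/(4*w))^3/3 + 243 / (320 * w^3 * a * b)))
     + (8 / a - 32 / (b * c) + (32 * w\<^sup>2 - 1) / (w * d))
    = (- 2 * (2 * (3/(4*w) + (3/(4*w))^3/3)) + (8 / a - 32 / (b * c) + (32 * w\<^sup>2 - 1) / (w * d)))
      - 243 * c * d / (80 * w^3 * a * b * c * d)"
  proof -
    have "243 * c * d / (80 * w^3 * a * b * c * d) = 4 * (243 / (320 * w^3 * a * b))"
      using pos by simp
    then show ?thesis by argo
  qed
  also have "\<dots> = (5 * (- (48 * w^2 + 9) * a * b * c * d + 128 * w^3 * b * c * d - 512 * w^3 * a * d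
       + 16 * w^2 * (32 * w\<^sup>2 - 1) * a * b * c) - 243 * c * d) / (80 * w^3 * a * b * c * d)"
  proof -
    have "n / (16 * w^3 * a * b * c * d) - m / (80 * w^3 * a * b * c * d) = (5 * n - m) / (80 * w^3 * a * b * c * d)" for n m
    proof -
      have "n / (16 * w^3 * a * b * c * d) = (5 * n) / (5 * (16 * w^3 * a * b * c * d))"
        by (rule mult_divide_mult_cancel_left[symmetric]) simp
      then show ?thesis by (simp add: diff_divide_distrib)
    qed
    then show ?thesis unfolding slope_common_denominator[OF pos] .
  qed
  also have "5 * (- (48 * w^2 + 9) * a * b * c * d + 128 * w^3 * b * c * d - 512 * w^3 * a * d
       + 16 * w^2 * (32 * w\<^sup>2 - 1) * a * b * c) - 243 * c * d
     = - 162 + 648 * w - 7344 * w^2 + 35136 * w^3 - 23040 * w^4 + 266240 * w^5 - 81920 * w^6"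
    unfolding a_def b_def c_def d_def by algebra
  finally show ?thesis unfolding a_def b_def c_def d_def .
qed

lemma renyi_slope_ge_0:
  assumes "2 \<le> t" "t \<le> 79/20"
  shows "renyi_slope t \<ge> 0"
proof -
  define p where "p = t - 2"
  define w where "w = p + 5/4"
  have p: "0 \<le> p" "p \<le> 39/20" and t: "t = w + 3/4" using assms by (auto simp: p_def w_def)
  \<comment> \<open>Only the powers 4 to 6 have negative coefficients. They are reduced to
    \<open>p^3\<close>, and \<open>p^3\<close> to lower powers, so that linear arithmetic decides
    the sign.\<close>
  have "p^4 \<le> (39/20) * p^3" "p^5 \<le> (39/20)^2 * p^3" "p^6 \<le> (39/20)^3 * p^3"
    using p mult_right_mono[OF p(2), of "p^3"] mult_right_mono[OF power_mono[OF p(2), of 2], of "p^3"]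
      mult_right_mono[OF power_mono[OF p(2), of 3], of "p^3"] by (simp_all add: eval_nat_numeral mult_ac)
  moreover have "p^3 \<le> (39/20) * p^2" "p^3 \<le> (39/20)^2 * p" "p^3 \<le> (39/20)^3"
    using p mult_right_mono[OF p(2), of "p^2"] mult_right_mono[OF power_mono[OF p(2), of 2], of "p"]
      power_mono[OF p(2), of 3] by (simp_all add: eval_nat_numeral mult_ac)
  moreover have "p^2 \<ge> 0" "p^3 \<ge> 0" using p by auto
  ultimately have "0 \<le> 501548 + 1716988 * p + 2108416 * p^2 + 879936 * p^3 - 279040 * p^4 - 348160 * p^5 - 81920 * p^6"
    using p by (simp add: eval_nat_numeral)
  also have "\<dots> = - 162 + 648 * w - 7344 * w^2 + 35136 * w^3 - 23040 * w^4 + 266240 * w^5 - 81920 * w^6"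
    unfolding w_def by algebra
  finally have "0 \<le> (- 162 + 648 * w - 7344 * w^2 + 35136 * w^3 - 23040 * w^4 + 266240 * w^5 - 81920 * w^6)
      / (80 * w^3 * (4*w - 3) * (4*w + 3) * (4*w - 1) * (32 * w\<^sup>2 + 1))"
    using p by (intro divide_nonneg_nonneg mult_nonneg_nonneg) (auto simp: w_def)
  then show ?thesis
    using renyi_slope_ge[of w] p unfolding t by (simp add: w_def)
qed

text \<open>The maximum of \<^const>\<open>renyi_log\<close> lies in this short interval.\<close>

lemma renyi_slope_ge_small:
  assumes "79/20 \<le> t" "t \<le> 4"
  shows "renyi_slope t \<ge> - (9/10000)"
proof -
  define s where "s = t - 79/20"
  define w where "w = s + 16/5"
  have s: "0 \<le> s" "s \<le> 1/20" and t: "t = w + 3/4" using assms by (auto simp: s_def w_def)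
  \<comment> \<open>On an interval of length 1/20 every higher power of \<open>s\<close> is at most
    a small multiple of \<open>s\<close>, which makes the inequality linear.\<close>
  have sk: "s ^ Suc k \<le> (1/20)^k * s" for k
    using mult_right_mono[OF power_mono[OF s(2), of k], of s] s by (simp add: mult_ac)
  let ?T = "- 20250 + 81000 * w - 918000 * w^2 + 4392081 * w^3 - 2880324 * w^4 + 33282448 * w^5
    - 10249792 * w^6 - 4608 * w^7 + 18432 * w^8"
  let ?S = "- 162 + 648 * w - 7344 * w^2 + 35136 * w^3 - 23040 * w^4 + 266240 * w^5 - 81920 * w^6"
  let ?D = "80 * w^3 * (4*w - 3) * (4*w + 3) * (4*w - 1) * (32 * w\<^sup>2 + 1)"
  have D: "?D > 0" using s by (intro mult_pos_pos) (auto simp: w_def intro: add_nonneg_pos)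
  have "0 \<le> (70964655676582/390625) + (-231433420380344/78125) * s + (-75462086015104/15625) * s^2 + (-9413194834683/3125) * s^3 + (-114340320052/125) * s^4 + (-16335199408/125) * s^5 + (-126704704/25) * s^6 + (2336256/5) * s^7 + (18432/1) * s^8"
    using s sk[of 1] sk[of 2] sk[of 3] sk[of 4] sk[of 5] zero_le_power[OF s(1), of 7] zero_le_power[OF s(1), of 8]
    by (simp add: eval_nat_numeral)
  also have "\<dots> = ?T" unfolding w_def by algebra
  \<comment> \<open>The factor 125 turns \<open>9/10000 * 80\<close> into 9, so \<open>?T\<close>
    has integer coefficients.\<close>
  also have "\<dots> = 125 * (?S + 9/10000 * ?D)" by algebra
  finally have "- (9/10000) \<le> ?S / ?D" using D by (simp add: pos_le_divide_eq)
  then show ?thesis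
    using renyi_slope_ge[of w] s unfolding t by (simp add: w_def)
qed

lemma renyi_log_antimono:
  assumes "4 \<le> s" "s \<le> t"
  shows "renyi_log t \<le> renyi_log s"
proof (rule DERIV_nonpos_imp_nonincreasing[OF assms(2)])
  fix x assume "s \<le> x" "x \<le> t"
  then show "\<exists>y. (renyi_log has_real_derivative y) (at x) \<and> y \<le> 0"
    using assms DERIV_renyi_log[of x] renyi_slope_le_0[of x] by (intro exI[of _ "renyi_slope x"]) simp
qed

text \<open>A slope of at least -9/10000 on an interval of length 1/20 costs at most 45/1000000. The
  reference point t = 4, that is \<alpha> = 3/4, is where \<open>exp (renyi_log t)\<close> is
  rational and close to its maximum.\<close>

lemma renyi_log_le:
  assumes "t \<ge> 2"
  shows "renyi_log t \<le> renyi_log 4 + 45/1000000"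
proof -
  have inc: "renyi_log t \<le> renyi_log (79/20)" if "t \<le> 79/20"
  proof (rule DERIV_nonneg_imp_nondecreasing[OF that])
    fix x assume "t \<le> x" "x \<le> 79/20"
    then show "\<exists>y. (renyi_log has_real_derivative y) (at x) \<and> 0 \<le> y"
      using assms DERIV_renyi_log[of x] renyi_slope_ge_0[of x] by (intro exI[of _ "renyi_slope x"]) simp
  qed
  have mid: "renyi_log t + 9/10000 * t \<le> renyi_log 4 + 9/10000 * 4" if "79/20 \<le> t" "t \<le> 4" for t
  proof (rule DERIV_nonneg_imp_nondecreasing[OF that(2)])
    fix x assume "t \<le> x" "x \<le> 4"
    then show "\<exists>y. ((\<lambda>t. renyi_log t + 9/10000 * t) has_real_derivative y) (at x) \<and> 0 \<le> y"
      using that renyi_slope_ge_small[of x]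
      by (intro exI[of _ "renyi_slope x + 9/10000"] conjI DERIV_add DERIV_renyi_log DERIV_cmult_Id) auto
  qed
  have dec: "renyi_log t \<le> renyi_log 4" if "4 \<le> t"
    using that by (intro renyi_log_antimono) auto
  show ?thesis
    using inc mid[of t] mid[of "79/20"] dec by linarith
qed

lemma f_renyi_lt_1_le:
  assumes "t \<ge> 2"
  shows "f_renyi (1 - 1/t) < 0.58235"
proof -
  have e: "exp (45/1000000) \<le> (1::real) / (1 - 45/1000000)"
    using exp_ge_add_one_self[of "-(45/1000000)::real"] by (simp add: exp_minus field_simps)
  have "(f_renyi (1 - 1/t))\<^sup>2 \<le> 4 * pi * exp (renyi_log 4 + 45/1000000)"
    using renyi_log_le[OF assms] by (intro order_trans[OF f_renyi_sq_le(2)[OF assms]] mult_left_mono) auto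
  also have "\<dots> \<le> 4 * 3.1415927 * (exp (renyi_log 4) * (1 / (1 - 45/1000000)))"
    unfolding exp_add using pi_approx(2) e by (intro mult_mono) auto
  also have "\<dots> < 0.58235\<^sup>2"
    by (subst exp_renyi_log) (simp_all add: power2_eq_square powr_numeral eval_nat_numeral)
  finally show ?thesis
    by (rule power2_less_imp_less) simp
qed

text \<open>Since \<open>f_renyi (3/4) > 0.5823\<close>, this excludes \<alpha> in [5/6, 1) as a
  place of the maximum, so that compactness of [1/2, 5/6] can give its existence.\<close>

lemma f_renyi_ge_6_le:
  assumes "t \<ge> 6"
  shows "f_renyi (1 - 1/t) \<le> 0.5823"
proof -
  have "(f_renyi (1 - 1/t))\<^sup>2 \<le> 4 * pi * exp (renyi_log 6)"
    using renyi_log_antimono[of 6 t] assms by (intro order_trans[OF f_renyi_sq_le(2)] mult_left_mono) auto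
  also have "\<dots> \<le> 4 * 3.1415927 * exp (renyi_log 6)"
    using pi_approx(2) by (intro mult_mono) auto
  also have "\<dots> \<le> 0.5823\<^sup>2"
    by (subst exp_renyi_log) (simp_all add: power2_eq_square powr_numeral eval_nat_numeral)
  finally show ?thesis
    by (rule power2_le_imp_le) simp
qed


section \<open>The range \<alpha> >= 1, with t = 1 / (\<alpha> - 1) for \<alpha> > 1\<close>

lemma exp_3_gt: "exp (3::real) > 19"
proof -
  have "(41/32)^12 \<le> (exp (1/4::real))^12"
    using exp_lower_Taylor_quadratic[of "1/4::real"] by (intro power_mono) (auto simp: power2_eq_square)
  also have "\<dots> = exp 3" by (simp flip: exp_of_nat_mult)
  finally show ?thesis by (simp add: eval_nat_numeral)
qed

lemma f_renyi_gt_1: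
  assumes "t > 0"
  shows "f_renyi (1 + 1/t) = 2 * sqrt pi * t / (t + 1) / sqrt (2 * t + 3) *
     ((2 * t + 3) / (2 * t)) powr (- t) * (Gamma (t + 1 + 1/2) / Gamma (t + 1))"
proof -
  define \<alpha> where "\<alpha> = 1 + 1/t"
  have \<alpha>: "\<alpha> > 1" "\<alpha> - 1 = 1 / t" "1 / (1 - \<alpha>) = - t" "2 / \<alpha> = 2 * t / (t + 1)"
    "(3 * \<alpha> - 1) / 2 = (2 * t + 3) / (2 * t)" "3 * \<alpha> - 1 = (2 * t + 3) / t"
    "\<alpha> / (\<alpha> - 1) = t + 1"
    using assms by (simp_all add: \<alpha>_def field_simps)
  have s: "sqrt (pi / ((2 * t + 3) / t)) * sqrt (1 / t) = sqrt pi / sqrt (2 * t + 3)"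
    using assms by (simp add: real_sqrt_mult[symmetric] real_sqrt_divide[symmetric] field_simps)
  have "\<not> \<alpha> < 1" "\<alpha> \<noteq> 1" using \<alpha>(1) by auto
  then have "f_renyi \<alpha> = 2 * t / (t + 1) * (sqrt (pi / ((2 * t + 3) / t)) * sqrt (1 / t)) *
     ((2 * t + 3) / (2 * t)) powr (- t) * (Gamma (t + 1 + 1/2) / Gamma (t + 1))"
    unfolding f_renyi_def unfolding \<alpha>(7) unfolding \<alpha>(2-6)
    by (simp only: if_False mult.assoc times_divide_eq_right) (simp add: mult_ac)
  then show ?thesis unfolding s \<alpha>_def[symmetric] by simp
qed

text \<open>Away from the maximum the crude Gamma bound and one term of the artanh series suffice.
  The numbers \<open>2 * t\<close> and \<open>2 * t + 3\<close> are symmetric about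
  \<open>(4 * t + 3) / 2\<close>, hence the argument \<open>3 / (4 * t + 3)\<close>.\<close>

lemma f_renyi_gt_1_sq_le:
  assumes "t > 0"
  shows "(f_renyi (1 + 1/t))\<^sup>2 \<le> 4 * pi * (t\<^sup>2 / ((t + 1) * (2 * t + 3))) * exp (- (12 * t / (4 * t + 3)))"
proof -
  have u: "0 < 3 / (4 * t + 3)" "3 / (4 * t + 3) < 1" using assms by (auto simp: field_simps)
  have "1 + 3 / (4 * t + 3) = 2 * (2 * t + 3) / (4 * t + 3)" "1 - 3 / (4 * t + 3) = 2 * (2 * t) / (4 * t + 3)"
    using assms by (simp_all add: field_simps)
  then have "(1 + 3 / (4 * t + 3)) / (1 - 3 / (4 * t + 3)) = (2 * (2 * t + 3)) / (2 * (2 * t))"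
    using assms by (simp only: divide_divide_eq_right divide_divide_eq_left) simp
  also have "\<dots> = (2 * t + 3) / (2 * t)" by (rule mult_divide_mult_cancel_left) simp
  finally have "(1 + 3 / (4 * t + 3)) / (1 - 3 / (4 * t + 3)) = (2 * t + 3) / (2 * t)" .
  then have "2 * (3 / (4 * t + 3)) \<le> ln ((2 * t + 3) / (2 * t))"
    using ln_artanh_ge[OF u] by simp
  from mult_left_mono[OF this, of "2 * t"]
  have l: "12 * t / (4 * t + 3) \<le> 2 * t * ln ((2 * t + 3) / (2 * t))"
    using assms by (simp add: mult_ac)
  have "(((2 * t + 3) / (2 * t)) powr (- t))\<^sup>2 = exp (- (2 * t * ln ((2 * t + 3) / (2 * t))))"
    using assms by (simp add: powr_def exp_double[symmetric] mult_ac)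
  then have p: "(((2 * t + 3) / (2 * t)) powr (- t))\<^sup>2 \<le> exp (- (12 * t / (4 * t + 3)))"
    using l by simp
  have "(f_renyi (1 + 1/t))\<^sup>2 = 4 * pi * (t\<^sup>2 / (t + 1)\<^sup>2 / (2 * t + 3)) *
      (((2 * t + 3) / (2 * t)) powr (- t))\<^sup>2 * (Gamma (t + 1 + 1/2) / Gamma (t + 1))\<^sup>2"
    unfolding f_renyi_gt_1[OF assms] power_mult_distrib using assms
    by (simp add: power_divide power_mult_distrib)
  also have "\<dots> \<le> 4 * pi * (t\<^sup>2 / (t + 1)\<^sup>2 / (2 * t + 3)) * exp (- (12 * t / (4 * t + 3))) * (t + 1)"
    using assms p Gamma_half_ratio_le[of "t + 1"] by (intro mult_mono) auto
  also have "\<dots> = 4 * pi * (t\<^sup>2 / ((t + 1) * (2 * t + 3))) * exp (- (12 * t / (4 * t + 3)))"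
    using assms by (simp add: power2_eq_square)
  finally show ?thesis .
qed

lemma f_renyi_gt_1_le:
  assumes "t > 0"
  shows "f_renyi (1 + 1/t) \<le> 0.5823"
proof -
  \<comment> \<open>1349/50000 is a rational number just below
    \<open>0.5823^2 / (4 * pi)\<close>.\<close>
  have "(t\<^sup>2 / ((t + 1) * (2 * t + 3))) * exp (- (12 * t / (4 * t + 3))) \<le> (1349/50000)"
  proof (cases "t \<ge> 3/4")
    case True
    \<comment> \<open>\<open>u = (A - B) / (A + B)\<close> for
      \<open>A = (t + 1) * (2 * t + 3)\<close> and \<open>B = 2 * t^2\<close>, so that
      \<open>(1 + u) / (1 - u) = A / B\<close>.\<close>
    define D where "D = 4 * t\<^sup>2 + 5 * t + 3"
    define u where "u = (5 * t + 3) / D"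
    have D: "D > 0" unfolding D_def using assms by (intro add_pos_pos) auto
    have "5 * t + 3 < D" using assms by (simp add: D_def)
    then have u: "0 < u" "u < 1" using D assms by (auto simp: u_def)
    \<comment> \<open>The polynomial is \<open>(4 * t - 3) * (t + 3)\<close>; its root 3/4 dictates
      the case distinction.\<close>
    have "4 * t\<^sup>2 + 9 * t - 9 \<ge> 0"
      using True mult_mono[OF True True] by (simp add: power2_eq_square)
    then have "9 * D \<le> 2 * (5 * t + 3) * (4 * t + 3)"
      by (simp add: D_def algebra_simps power2_eq_square)
    then have "9 / (4 * t + 3) \<le> 2 * u"
      unfolding u_def using D assms by (simp add: divide_simps mult_ac)
    also have "\<dots> \<le> ln ((1 + u) / (1 - u))"
      by (rule ln_artanh_ge[OF u])
    also have "(1 + u) / (1 - u) = (t + 1) * (2 * t + 3) / (2 * t\<^sup>2)"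
    proof -
      have "1 + u = (D + (5 * t + 3)) / D" "1 - u = (D - (5 * t + 3)) / D"
        using D unfolding u_def add_divide_distrib[of D] diff_divide_distrib[of D] by simp_all
      moreover have "D + (5 * t + 3) = 2 * ((t + 1) * (2 * t + 3))" "D - (5 * t + 3) = 2 * (2 * t\<^sup>2)"
        unfolding D_def by algebra+
      ultimately have "(1 + u) / (1 - u) = 2 * ((t + 1) * (2 * t + 3)) / (2 * (2 * t\<^sup>2))"
        using D by (simp only: divide_divide_eq_right divide_divide_eq_left) simp
      also have "\<dots> = (t + 1) * (2 * t + 3) / (2 * t\<^sup>2)"
        by (rule mult_divide_mult_cancel_left) simp
      finally show ?thesis .
    qed
    finally have "exp (9 / (4 * t + 3)) \<le> (t + 1) * (2 * t + 3) / (2 * t\<^sup>2)"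
      using assms by (subst (asm) ln_ge_iff) auto
    \<comment> \<open>The bound 1/2 is the limit for t to infinity, that is for \<alpha> to 1. With
      \<open>exp 3 > 19\<close> it leaves 1/38, which is below 1349/50000.\<close>
    from mult_left_mono[OF this, of "t\<^sup>2 / ((t + 1) * (2 * t + 3))"]
    have "(t\<^sup>2 / ((t + 1) * (2 * t + 3))) * exp (9 / (4 * t + 3)) \<le> 1/2"
      using assms by simp
    moreover have "- (12 * t / (4 * t + 3)) = 9 / (4 * t + 3) - 3"
    proof -
      have "12 * t / (4 * t + 3) = (3 * (4 * t + 3) - 9) / (4 * t + 3)" by simp
      also have "\<dots> = 3 * (4 * t + 3) / (4 * t + 3) - 9 / (4 * t + 3)" by (rule diff_divide_distrib)
      also have "3 * (4 * t + 3) / (4 * t + 3) = 3"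
        by (rule nonzero_mult_div_cancel_right) (use assms in auto)
      finally show ?thesis by simp
    qed
    ultimately have "(t\<^sup>2 / ((t + 1) * (2 * t + 3))) * exp (- (12 * t / (4 * t + 3))) \<le> 1/2 / exp 3"
      by (simp only: exp_diff times_divide_eq_right divide_right_mono exp_ge_zero)
    also have "\<dots> \<le> 1/2 / 19"
      using exp_3_gt by (intro divide_left_mono) auto
    finally show ?thesis by simp
  next
    case False
    have "2 * t \<le> 12 * t / (4 * t + 3)"
    proof -
      have "t * (4 * t + 3) \<le> t * 6" using False assms by (intro mult_left_mono) auto
      then show ?thesis using assms by (simp add: pos_le_divide_eq algebra_simps)
    qed
    then have "exp (- (12 * t / (4 * t + 3))) \<le> exp (- (2 * t))" by simp
    also have "\<dots> \<le> 1 / (1 + 2 * t + 2 * t\<^sup>2)"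
      using exp_lower_Taylor_quadratic[of "2 * t"] assms unfolding exp_minus inverse_eq_divide
      by (intro frac_le) (auto simp: power2_eq_square intro: add_pos_nonneg)
    finally have "(t\<^sup>2 / ((t + 1) * (2 * t + 3))) * exp (- (12 * t / (4 * t + 3)))
       \<le> (t\<^sup>2 / ((t + 1) * (2 * t + 3))) * (1 / (1 + 2 * t + 2 * t\<^sup>2))"
      using assms by (intro mult_left_mono) auto
    also have "\<dots> = t\<^sup>2 / ((t + 1) * (2 * t + 3) * (1 + 2 * t + 2 * t\<^sup>2))" by simp
    also have "\<dots> \<le> (1349/50000)"
    proof -
      let ?P = "3 + 11 * t + 18 * t\<^sup>2 + 14 * t^3 + 4 * t^4"
      have "t\<^sup>2 \<le> 3/4 * t" using False assms by (simp add: power2_eq_square)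
      moreover have "t^3 \<ge> 0" "t^4 \<ge> 0" using assms by auto
      ultimately have "t\<^sup>2 \<le> (1349/50000) * ?P"
        using False unfolding distrib_left by linarith
      moreover have "?P > 0" using assms by (intro add_pos_pos mult_pos_pos zero_less_power) auto
      moreover have "(t + 1) * (2 * t + 3) * (1 + 2 * t + 2 * t\<^sup>2) = ?P"
        by algebra
      ultimately show ?thesis by (simp only: pos_divide_le_eq)
    qed
    finally show ?thesis .
  qed
  then have "4 * pi * ((t\<^sup>2 / ((t + 1) * (2 * t + 3))) * exp (- (12 * t / (4 * t + 3)))) \<le> 4 * pi * (1349/50000)"
    by (rule mult_left_mono) simp
  also have "\<dots> \<le> 4 * 3.1415927 * (1349/50000)"
    using pi_approx(2) by simp
  also have "\<dots> \<le> 0.5823\<^sup>2" by (simp add: power2_eq_square)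
  finally have "(f_renyi (1 + 1/t))\<^sup>2 \<le> 0.5823\<^sup>2"
    using f_renyi_gt_1_sq_le[OF assms] by (simp only: mult.assoc)
  then show ?thesis by (rule power2_le_imp_le) simp
qed

lemma f_renyi_1_le: "f_renyi 1 \<le> 0.5823"
proof -
  have "2 * pi / exp 3 \<le> 2 * 3.1415927 / 19"
    using exp_3_gt pi_approx(2) by (intro frac_le) auto
  also have "\<dots> \<le> 0.5823\<^sup>2" by (simp add: power2_eq_square)
  finally have "sqrt (2 * pi / exp 3) \<le> 0.5823"
    by (intro real_le_lsqrt) auto
  then show ?thesis
    unfolding f_renyi_def by simp
qed

section \<open>Existence and numerical value of the maximum\<close>

lemma f_renyi_ge_5_6_le:
  assumes "\<alpha> \<ge> 5/6"
  shows "f_renyi \<alpha> \<le> 0.5823"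
proof (cases \<alpha> "1::real" rule: linorder_cases)
  case less
  then have "1 / (1 - \<alpha>) \<ge> 6" "\<alpha> = 1 - 1 / (1 / (1 - \<alpha>))"
    using assms by (auto simp: field_simps)
  then show ?thesis using f_renyi_ge_6_le[of "1 / (1 - \<alpha>)"] by simp
next
  case equal
  then show ?thesis using f_renyi_1_le by simp
next
  case greater
  then have "1 / (\<alpha> - 1) > 0" "\<alpha> = 1 + 1 / (1 / (\<alpha> - 1))"
    by auto
  then show ?thesis using f_renyi_gt_1_le[of "1 / (\<alpha> - 1)"] by simp
qed

lemma f_renyi_less:
  assumes "\<alpha> \<ge> 1/2"
  shows "f_renyi \<alpha> < 0.58235"
proof (cases "\<alpha> < 5/6")
  case True
  then have "1 / (1 - \<alpha>) \<ge> 2" "\<alpha> = 1 - 1 / (1 / (1 - \<alpha>))"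
    using assms by (auto simp: field_simps)
  then show ?thesis using f_renyi_lt_1_le[of "1 / (1 - \<alpha>)"] by simp
next
  case False
  then show ?thesis using f_renyi_ge_5_6_le[of \<alpha>] by simp
qed

lemma f_renyi_3_4: "f_renyi (3/4) > 0.5823"
proof -
  have G4: "Gamma (4::real) = 6"
    using Gamma_fact[of 3, where 'a=real] by (simp add: fact_numeral)
  have G72: "Gamma (7/2 :: real) = 15/8 * sqrt pi"
    using Gamma_real_plus1[of "1/2"] Gamma_real_plus1[of "3/2"] Gamma_real_plus1[of "5/2"]
    by (simp add: Gamma_one_half_real)
  have "f_renyi (3/4) = 125 / 96 / sqrt 5"
    using f_renyi_lt_1[of 4] G4 G72 by (simp add: powr_numeral eval_nat_numeral)
  moreover have "sqrt 5 < 125/96 / 0.5823"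
    by (rule real_less_lsqrt) (simp_all add: power2_eq_square)
  moreover from this have "0.5823 * sqrt 5 < 125 / 96" by simp
  ultimately show ?thesis by (simp add: pos_less_divide_eq)
qed

lemma continuous_on_f_renyi: "continuous_on {1/2..5/6} f_renyi"
proof -
  have "continuous_on {1/2..5/6} (\<lambda>\<alpha>::real. 2 / \<alpha> * sqrt (pi / (3 * \<alpha> - 1)) * ((3 * \<alpha> - 1) / 2) powr (1 / (1 - \<alpha>)) *
        (sqrt (1 - \<alpha>) * Gamma (1 / (1 - \<alpha>)) / Gamma (1 / (1 - \<alpha>) - 1 / 2)))"
  proof (rule continuous_at_imp_continuous_on, rule ballI)
    fix \<alpha> :: real assume a: "\<alpha> \<in> {1/2..5/6}"
    then have "1 / (1 - \<alpha>) \<ge> 2" by (auto simp: field_simps)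
    then have "1 / (1 - \<alpha>) \<notin> \<int>\<^sub>\<le>\<^sub>0" "1 / (1 - \<alpha>) - 1/2 \<notin> \<int>\<^sub>\<le>\<^sub>0" "Gamma (1 / (1 - \<alpha>) - 1/2) > 0"
      by (auto simp: nonpos_Ints_def)
    then show "isCont (\<lambda>\<alpha>::real. 2 / \<alpha> * sqrt (pi / (3 * \<alpha> - 1)) * ((3 * \<alpha> - 1) / 2) powr (1 / (1 - \<alpha>)) *
        (sqrt (1 - \<alpha>) * Gamma (1 / (1 - \<alpha>)) / Gamma (1 / (1 - \<alpha>) - 1 / 2))) \<alpha>"
      using a unfolding isCont_def
      by (intro tendsto_mult tendsto_divide tendsto_real_sqrt tendsto_powr tendsto_Gamma tendsto_diff
          tendsto_const tendsto_ident_at) (simp_all add: Gamma_eq_zero_iff)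
  qed
  then show ?thesis
    by (rule continuous_on_eq) (auto simp: f_renyi_def)
qed

lemma f_max_attained:
  obtains \<alpha> where "\<alpha> \<ge> 1/2" "f_renyi \<alpha> = f_max" "0.5823 < f_max" "f_max < 0.58235"
    "\<And>\<beta>. \<beta> \<ge> 1/2 \<Longrightarrow> f_renyi \<beta> \<le> f_max"
proof -
  obtain \<alpha> where \<alpha>: "\<alpha> \<in> {1/2..5/6}" "\<And>\<beta>. \<beta> \<in> {1/2..5/6} \<Longrightarrow> f_renyi \<beta> \<le> f_renyi \<alpha>"
    using continuous_attains_sup[OF _ _ continuous_on_f_renyi] by fastforce
  have gt: "f_renyi \<alpha> > 0.5823" using \<alpha>(2)[of "3/4"] f_renyi_3_4 by simp
  have le: "f_renyi \<beta> \<le> f_renyi \<alpha>" if "\<beta> \<ge> 1/2" for \<beta>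
    using \<alpha>(2)[of \<beta>] f_renyi_ge_5_6_le[of \<beta>] gt that by fastforce
  have "f_max = f_renyi \<alpha>"
    unfolding f_max_def using le \<alpha>(1) by (intro cSup_eq_maximum) auto
  then show ?thesis
    using that[of \<alpha>] \<alpha>(1) gt le f_renyi_less[of \<alpha>] by auto
qed


section \<open>Complex Hilbert spaces and positive forms\<close>

instance complex_hilbert_space \<subseteq> banach ..

section \<open>Algebra and Cauchy-Schwarz for the sesquilinear product\<close>

lemma cinner_add_left: "cinner (x + y) z = cinner x z + cinner y z"
  for x y z :: "'h::complex_hilbert_space"
  by (metis cinner_add_right cinner_commute complex_cnj_add)

lemma cinner_scaleC_left: "cinner (a *\<^sub>C x) y = cnj a * cinner x y"
  for x y :: "'h::complex_hilbert_space"
  by (metis cinner_scaleC_right cinner_commute complex_cnj_mult)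

lemma cinner_scaleR_right: "cinner x (r *\<^sub>R y) = of_real r * cinner x y"
  for x y :: "'h::complex_hilbert_space"
  by (simp add: scaleR_scaleC cinner_scaleC_right)

lemma cinner_zero_right [simp]: "cinner x 0 = 0" for x :: "'h::complex_hilbert_space"
  using cinner_add_right[of x 0 0] by simp

lemma cinner_zero_left [simp]: "cinner 0 x = 0" for x :: "'h::complex_hilbert_space"
  using cinner_add_left[of 0 0 x] by simp

lemma cinner_minus_right: "cinner x (- y) = - cinner x y" for x y :: "'h::complex_hilbert_space"
  using cinner_add_right[of x y "- y"] by (simp add: eq_neg_iff_add_eq_0 add.commute)

lemma cinner_diff_right: "cinner x (y - z) = cinner x y - cinner x z"
  for x y z :: "'h::complex_hilbert_space"
  using cinner_add_right[of x y "- z"] by (simp add: cinner_minus_right)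

lemma cinner_diff_left: "cinner (x - y) z = cinner x z - cinner y z"
  for x y z :: "'h::complex_hilbert_space"
  by (metis cinner_diff_right cinner_commute complex_cnj_diff)

lemma cinner_sum_right: "cinner x (\<Sum>i\<in>I. f i) = (\<Sum>i\<in>I. cinner x (f i))"
  for x :: "'h::complex_hilbert_space"
  by (induction I rule: infinite_finite_induct) (auto simp: cinner_add_right)

lemma cinner_sum_left: "cinner (\<Sum>i\<in>I. f i) x = (\<Sum>i\<in>I. cinner (f i) x)"
  for x :: "'h::complex_hilbert_space"
  by (induction I rule: infinite_finite_induct) (auto simp: cinner_add_left)

lemma mult_cnj_cmod: "z * cnj z = of_real ((cmod z)\<^sup>2)"
  by (rule complex_norm_square[symmetric])

lemma cinner_self: "cinner x x = of_real ((norm x)\<^sup>2)" for x :: "'h::complex_hilbert_space"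
proof -
  have "Im (cinner x x) = 0" using cinner_commute[of x x] by (metis cnj.simps(2) equal_neg_zero)
  moreover have "Re (cinner x x) = (norm x)\<^sup>2"
    by (simp add: inner_cinner[symmetric] power2_norm_eq_inner)
  ultimately show ?thesis by (simp add: complex_eq_iff)
qed

lemma norm_scaleC: "norm (a *\<^sub>C x) = cmod a * norm x" for x :: "'h::complex_hilbert_space"
proof -
  have "cinner (a *\<^sub>C x) (a *\<^sub>C x) = (a * cnj a) * cinner x x"
    by (simp add: cinner_scaleC_left cinner_scaleC_right)
  then have "(norm (a *\<^sub>C x))\<^sup>2 = (cmod a)\<^sup>2 * (norm x)\<^sup>2"
    unfolding mult_cnj_cmod cinner_self by (simp only: of_real_mult[symmetric] of_real_eq_iff)
  then have "(norm (a *\<^sub>C x))\<^sup>2 = (cmod a * norm x)\<^sup>2"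
    by (simp only: power_mult_distrib)
  then show ?thesis by (rule power2_eq_imp_eq) auto
qed

lemma scaleC_zero_left [simp]: "0 *\<^sub>C x = 0" for x :: "'h::complex_hilbert_space"
  using norm_scaleC[of 0 x] by simp

lemma scaleC_zero_right [simp]: "a *\<^sub>C (0 :: 'h::complex_hilbert_space) = 0"
  using norm_scaleC[of a 0] by simp

lemma scaleC_diff_right: "a *\<^sub>C (x - y) = a *\<^sub>C x - a *\<^sub>C y"
  for x y :: "'h::complex_hilbert_space"
  using scaleC_add_right[of a "x - y" y] by (simp add: eq_diff_eq)

lemma scaleC_one [simp]: "1 *\<^sub>C x = x" for x :: "'h::complex_hilbert_space"
  using scaleR_scaleC[of 1 x] by simp

lemma cmod_cinner_le: "cmod (cinner x y) \<le> norm x * norm y" for x y :: "'h::complex_hilbert_space"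
proof (cases "cinner x y = 0")
  case False
  \<comment> \<open>Multiplying \<open>y\<close> by this phase makes the product real and
    nonnegative, which reduces the claim to the real inner product.\<close>
  define u where "u = cnj (cinner x y) / cmod (cinner x y)"
  have u: "cmod u = 1" using False by (simp add: u_def norm_divide)
  have "cmod (cinner x y) = Re (cinner x (u *\<^sub>C y))"
    using False by (simp add: u_def cinner_scaleC_right complex_norm_square[symmetric] mult.commute power2_eq_square)
  also have "\<dots> \<le> norm x * norm (u *\<^sub>C y)"
    unfolding inner_cinner[symmetric] by (rule norm_cauchy_schwarz)
  finally show ?thesis by (simp add: norm_scaleC u)
qed simp

lemma bounded_linear_cinner_right: "bounded_linear (cinner x)" for x :: "'h::complex_hilbert_space"
proof (rule bounded_linear_intro[of _ "norm x"])
  show "norm (cinner x y) \<le> norm y * norm x" for y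
    using cmod_cinner_le[of x y] by (simp only: mult.commute)
qed (auto simp: cinner_add_right cinner_scaleR_right scaleR_conv_of_real)

section \<open>Expansions in the number basis and phase shifts\<close>

context
  fixes e :: "nat \<Rightarrow> 'h::complex_hilbert_space"
  assumes basis: "orthonormal_basis e"
begin

lemma cinner_basis: "cinner (e m) (e n) = (if m = n then 1 else 0)"
  using basis unfolding orthonormal_basis_def by blast

lemma basis_expansion: "(\<lambda>n. cinner (e n) x *\<^sub>C e n) sums x"
  using basis unfolding orthonormal_basis_def by blast

lemma norm_basis: "norm (e n) = 1"
  unfolding norm_eq_sqrt_inner inner_cinner by (simp add: cinner_basis)

lemma basis_Parseval: "(\<lambda>n. cinner x (e n) * cinner (e n) y) sums cinner x y"
  using bounded_linear.sums[OF bounded_linear_cinner_right basis_expansion, of x y]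
  by (simp add: cinner_scaleC_right mult.commute)

lemma basis_norm_sums: "(\<lambda>n. (cmod (cinner (e n) x))\<^sup>2) sums (norm x)\<^sup>2"
proof -
  have "cinner x (e n) * cinner (e n) x = of_real ((cmod (cinner (e n) x))\<^sup>2)" for n
    using cinner_commute[of x "e n"] by (simp add: mult_cnj_cmod mult.commute)
  then have "(\<lambda>n. complex_of_real ((cmod (cinner (e n) x))\<^sup>2)) sums of_real ((norm x)\<^sup>2)"
    using basis_Parseval[of x x] by (simp only: cinner_self)
  then show ?thesis by (simp only: sums_of_real_iff)
qed

lemma basis_coeff_unique:
  assumes "(\<lambda>n. c n *\<^sub>C e n) sums y"
  shows "cinner (e m) y = c m"
proof -
  have "(\<lambda>n. c n * cinner (e m) (e n)) sums cinner (e m) y"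
    using bounded_linear.sums[OF bounded_linear_cinner_right assms, of "e m"] by (simp add: cinner_scaleC_right)
  moreover have "(\<lambda>n. c n * cinner (e m) (e n)) = (\<lambda>n. if n = m then c n else 0)"
    by (auto simp: cinner_basis)
  ultimately show ?thesis using sums_unique2 sums_single by metis
qed

text \<open>Riesz-Fischer: by Pythagoras the squared norm of a block of the series is the
  corresponding block of the coefficient series, so the Cauchy criterion carries over.\<close>

lemma basis_series_summable:
  assumes "summable (\<lambda>n. (cmod (c n))\<^sup>2)"
  shows "summable (\<lambda>n. c n *\<^sub>C e n)"
  unfolding summable_Cauchy
proof (intro allI impI)
  fix \<epsilon> :: real assume "\<epsilon> > 0"
  have n: "(norm (\<Sum>i\<in>I. c i *\<^sub>C e i))\<^sup>2 = (\<Sum>i\<in>I. (cmod (c i))\<^sup>2)" if "finite I" for I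
    using that
    by (subst norm_sum_Pythagorean)
       (auto simp: pairwise_def orthogonal_def inner_cinner cinner_scaleC_left cinner_scaleC_right cinner_basis
          norm_scaleC norm_basis)
  obtain N where N: "\<And>m n. m \<ge> N \<Longrightarrow> norm (\<Sum>i=m..<n. (cmod (c i))\<^sup>2) < \<epsilon>\<^sup>2"
    using assms \<open>\<epsilon> > 0\<close> unfolding summable_Cauchy by (metis zero_less_power)
  have "norm (\<Sum>i=m..<n. c i *\<^sub>C e i) < \<epsilon>" if "m \<ge> N" for m n
  proof (rule power2_less_imp_less)
    show "(norm (\<Sum>i=m..<n. c i *\<^sub>C e i))\<^sup>2 < \<epsilon>\<^sup>2"
      using N[OF that, of n] by (subst n) auto
  qed (use \<open>\<epsilon> > 0\<close> in auto)
  then show "\<exists>N. \<forall>m\<ge>N. \<forall>n. norm (\<Sum>i=m..<n. c i *\<^sub>C e i) < \<epsilon>" by blast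
qed

text \<open>The bound on \<open>g\<close> keeps the coefficients square summable, so the
  \<open>suminf\<close> in \<open>diagonal_op\<close> is a genuine limit for every
  \<open>x\<close>.\<close>

lemma cinner_basis_diagonal_op:
  assumes "\<And>n. cmod (g n) \<le> 1"
  shows "cinner (e n) (diagonal_op e g x) = g n * cinner (e n) x"
proof -
  have bd: "norm ((cmod (g n * cinner (e n) x))\<^sup>2) \<le> (cmod (cinner (e n) x))\<^sup>2" for n
    using power_mono[of "cmod (g n * cinner (e n) x)" "cmod (cinner (e n) x)" 2] assms[of n]
    by (simp add: norm_mult mult_left_le_one_le)
  have "summable (\<lambda>n. (cmod (g n * cinner (e n) x))\<^sup>2)"
    by (rule summable_comparison_test'[OF sums_summable[OF basis_norm_sums[of x]] bd])
  then have "(\<lambda>n. (g n * cinner (e n) x) *\<^sub>C e n) sums diagonal_op e g x"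
    unfolding diagonal_op_def scaleC_scaleC by (intro summable_sums basis_series_summable)
  then show ?thesis by (rule basis_coeff_unique)
qed

lemma diagonal_op_basis: "diagonal_op e g (e n) = g n *\<^sub>C e n"
proof -
  have "(\<lambda>m. g m *\<^sub>C (cinner (e m) (e n) *\<^sub>C e m)) = (\<lambda>m. if m = n then g m *\<^sub>C e m else 0)"
    by (auto simp: cinner_basis)
  then show ?thesis
    unfolding diagonal_op_def using sums_single[of n "\<lambda>m. g m *\<^sub>C e m"] sums_unique by metis
qed

lemma cinner_basis_phase_op:
  "cinner (e n) (phase_op e \<theta> x) = exp (- \<i> * of_nat n * of_real \<theta>) * cinner (e n) x"
  unfolding phase_op_def by (rule cinner_basis_diagonal_op) (simp add: norm_exp_eq_Re)

lemma norm_phase_op: "norm (phase_op e \<theta> x) = norm x"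
proof -
  have "cmod (cinner (e n) (phase_op e \<theta> x)) = cmod (cinner (e n) x)" for n
    by (simp add: cinner_basis_phase_op norm_mult norm_exp_eq_Re)
  then have "(norm (phase_op e \<theta> x))\<^sup>2 = (norm x)\<^sup>2"
    using basis_norm_sums[of "phase_op e \<theta> x"] by (intro sums_unique2[OF _ basis_norm_sums[of x]]) simp
  then show ?thesis by simp
qed

lemma phase_op_adjoint: "cinner x (phase_op e (- \<theta>) y) = cinner (phase_op e \<theta> x) y"
proof -
  have "cinner x (e n) * cinner (e n) (phase_op e (- \<theta>) y) = cinner (phase_op e \<theta> x) (e n) * cinner (e n) y" for n
    using cinner_commute[of x "e n"] cinner_commute[of "phase_op e \<theta> x" "e n"]
    by (simp add: cinner_basis_phase_op exp_cnj)
  then show ?thesis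
    using basis_Parseval[of x "phase_op e (- \<theta>) y"] basis_Parseval[of "phase_op e \<theta> x" y]
      sums_unique2 by simp
qed

lemma phase_op_basis: "phase_op e \<theta> (e n) = exp (- \<i> * of_nat n * of_real \<theta>) *\<^sub>C e n"
  unfolding phase_op_def by (rule diagonal_op_basis)

lemma number_op_basis: "number_op e (e n) = of_nat n *\<^sub>C e n"
  unfolding number_op_def by (rule diagonal_op_basis)

end


section \<open>Positive forms: Cauchy-Schwarz, Cholesky elimination and filtering\<close>

locale positive_form =
  fixes A :: "'h::complex_hilbert_space \<Rightarrow> 'h"
  assumes add: "A (x + y) = A x + A y"
    and scale: "A (a *\<^sub>C x) = a *\<^sub>C A x"
    and nonneg: "cinner x (A x) \<in> \<real>\<^sub>\<ge>\<^sub>0"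
begin

definition q :: "'h \<Rightarrow> real" where "q x = Re (cinner x (A x))"

lemma q_nonneg [simp]: "q x \<ge> 0"
  using nonneg[of x] by (simp add: q_def complex_nonneg_Reals_iff)

lemma cinner_q: "cinner x (A x) = of_real (q x)"
  using nonneg[of x] by (simp add: q_def complex_nonneg_Reals_iff complex_eq_iff)

lemma diff: "A (x - y) = A x - A y"
proof -
  have "A (x - y) + A y = A x" using add[of "x - y" y] by simp
  then show ?thesis by (simp add: eq_diff_eq)
qed

text \<open>Polarisation: the form is real at \<open>x + y\<close> and at
  \<open>x + \<i> *\<^sub>C y\<close>, which fixes the imaginary and the real parts.\<close>

lemma hermitian: "cinner x (A y) = cinner (A x) y"
proof -
  let ?a = "cinner x (A y)" and ?b = "cinner y (A x)"
  have "Im (cinner (x + y) (A (x + y))) = 0" "Im (cinner (x + \<i> *\<^sub>C y) (A (x + \<i> *\<^sub>C y))) = 0"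
    by (simp_all add: cinner_q)
  then have "Im ?a + Im ?b = 0" "Re ?a - Re ?b = 0"
    by (simp_all add: add scale cinner_add_left cinner_add_right cinner_scaleC_left cinner_scaleC_right cinner_q)
  then have "?a = cnj ?b" by (simp add: complex_eq_iff)
  then show ?thesis using cinner_commute[of "A x" y] by simp
qed

lemma cinner_swap: "cinner y (A x) = cnj (cinner x (A y))"
  by (subst hermitian[of x y]) (rule cinner_commute)

text \<open>The parabola in \<open>s\<close> behind the Cauchy-Schwarz inequality; its vertex is at
  \<open>s = 1 / q y\<close>.\<close>

lemma q_diff_scale: "q (x - (of_real s * cinner y (A x)) *\<^sub>C y)
    = q x - 2 * s * (cmod (cinner y (A x)))\<^sup>2 + s\<^sup>2 * (cmod (cinner y (A x)))\<^sup>2 * q y"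
proof -
  let ?b = "cinner y (A x)"
  have n: "?b * cnj ?b = of_real ((cmod ?b)\<^sup>2)" by (simp add: mult_cnj_cmod)
  have "cinner (x - (of_real s * ?b) *\<^sub>C y) (A (x - (of_real s * ?b) *\<^sub>C y))
    = of_real (q x) - of_real (2 * s) * (?b * cnj ?b) + of_real (s\<^sup>2 * q y) * (?b * cnj ?b)"
    by (simp add: diff scale cinner_diff_left cinner_diff_right cinner_scaleC_left cinner_scaleC_right
      cinner_q cinner_swap[of x y] algebra_simps power2_eq_square)
  also have "\<dots> = of_real (q x - 2 * s * (cmod ?b)\<^sup>2 + s\<^sup>2 * (cmod ?b)\<^sup>2 * q y)"
    unfolding n by simp
  finally show ?thesis by (simp add: q_def[of "x - _"])
qed

lemma Cauchy_Schwarz: "(cmod (cinner y (A x)))\<^sup>2 \<le> q x * q y"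
proof (cases "q y = 0")
  case False
  then have pos: "q y > 0" using q_nonneg[of y] by linarith
  have "0 \<le> q (x - (of_real (1 / q y) * cinner y (A x)) *\<^sub>C y)" by simp
  also have "\<dots> = q x - (cmod (cinner y (A x)))\<^sup>2 / q y"
    unfolding q_diff_scale using pos by (simp add: field_simps power2_eq_square)
  finally show ?thesis using pos by (simp add: pos_divide_le_eq)
next
  case True
  have "cinner y (A x) = 0"
  proof (rule ccontr)
    assume "cinner y (A x) \<noteq> 0"
    then have b: "(cmod (cinner y (A x)))\<^sup>2 > 0" by simp
    \<comment> \<open>For \<open>q y = 0\<close> the parabola is a decreasing affine function of
      \<open>s\<close>, and this \<open>s\<close> lies beyond its zero.\<close>
    define s where "s = (q x + 1) / (cmod (cinner y (A x)))\<^sup>2"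
    have "0 \<le> q (x - (of_real s * cinner y (A x)) *\<^sub>C y)" by simp
    also have "\<dots> = q x - 2 * (q x + 1)"
      unfolding q_diff_scale True using b by (simp add: s_def)
    finally show False using q_nonneg[of x] by simp
  qed
  then show ?thesis using True by simp
qed

text \<open>One step of Cholesky elimination; if \<open>q y = 0\<close> then \<open>A y = 0\<close> and the junk value of the
  division is harmless.\<close>

lemma deflate:
  fixes y
  defines "\<psi> \<equiv> of_real (1 / sqrt (q y)) *\<^sub>C A y"
  defines "B \<equiv> \<lambda>x. A x - cinner \<psi> x *\<^sub>C \<psi>"
  shows "positive_form B" "B y = 0" "\<And>z. A z = 0 \<Longrightarrow> B z = 0" "\<And>z. A z = 0 \<Longrightarrow> cinner \<psi> z = 0"
proof -
  have \<psi>: "cinner \<psi> x = of_real (1 / sqrt (q y)) * cinner y (A x)" for x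
    by (simp add: \<psi>_def cinner_scaleC_left hermitian)
  show B: "positive_form B"
  proof
    fix x z a
    show "B (x + z) = B x + B z"
      by (simp add: B_def add cinner_add_right scaleC_add_left)
    show "B (a *\<^sub>C x) = a *\<^sub>C B x"
      by (simp add: B_def scale cinner_scaleC_right scaleC_scaleC scaleC_diff_right)
    have "cinner x \<psi> = cnj (cinner \<psi> x)" by (rule cinner_commute)
    then have "cinner x (B x) = of_real (q x - (cmod (cinner \<psi> x))\<^sup>2)"
      by (simp add: B_def cinner_diff_right cinner_q cinner_scaleC_right mult_cnj_cmod)
    moreover have "(cmod (cinner \<psi> x))\<^sup>2 \<le> q x"
      using Cauchy_Schwarz[of y x] q_nonneg[of y]
      by (cases "q y = 0") (auto simp: \<psi> norm_mult norm_divide power_mult_distrib power_divide divide_le_eq less_le)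
    ultimately show "cinner x (B x) \<in> \<real>\<^sub>\<ge>\<^sub>0"
      by (simp only: nonneg_Reals_of_real_iff diff_ge_0_iff_ge)
  qed
  show "B y = 0"
  proof (cases "q y = 0")
    case True
    then have "cinner (A y) (A y) = 0" using Cauchy_Schwarz[of "A y" y] by simp
    then have "A y = 0" by (simp add: cinner_self)
    then show ?thesis by (simp add: B_def \<psi>_def)
  next
    case False
    then have "cinner \<psi> y *\<^sub>C \<psi> = A y"
      using q_nonneg[of y]
      by (simp add: \<psi> cinner_q) (simp add: \<psi>_def scaleC_scaleC flip: of_real_mult of_real_divide)
    then show ?thesis by (simp add: B_def)
  qed
  show "cinner \<psi> z = 0" if "A z = 0" for z
    using that by (simp add: \<psi>)
  then show "B z = 0" if "A z = 0" for z
    using that by (simp add: B_def)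
qed

text \<open>The remainder \<open>R k\<close> after \<open>k\<close> eliminations annihilates
  \<open>e 0\<close>, ..., \<open>e (k - 1)\<close>, and every later factor is orthogonal to these
  vectors. Hence the expansion of \<open>A (e n)\<close> is complete after step \<open>n\<close>,
  without any limit.\<close>

lemma cholesky:
  fixes e :: "nat \<Rightarrow> 'h"
  obtains \<psi> where "\<And>j n. n < j \<Longrightarrow> cinner (\<psi> j) (e n) = 0"
    and "\<And>n. A (e n) = (\<Sum>j\<le>n. cinner (\<psi> j) (e n) *\<^sub>C \<psi> j)"
proof -
  define pivot :: "('h \<Rightarrow> 'h) \<Rightarrow> nat \<Rightarrow> 'h" where
    "pivot = (\<lambda>R k. of_real (1 / sqrt (positive_form.q R (e k))) *\<^sub>C R (e k))"
  define R where "R = rec_nat A (\<lambda>k R x. R x - cinner (pivot R k) x *\<^sub>C pivot R k)"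
  define \<psi> where "\<psi> k = pivot (R k) k" for k
  have R0: "R 0 = A" and RS: "R (Suc k) = (\<lambda>x. R k x - cinner (\<psi> k) x *\<^sub>C \<psi> k)" for k
    by (simp_all add: R_def \<psi>_def)
  have pos: "positive_form (R k)" for k
  proof (induction k)
    case 0
    then show ?case by (simp add: R0 positive_form_axioms)
  next
    case (Suc k)
    then show ?case
      unfolding RS \<psi>_def pivot_def by (rule positive_form.deflate(1))
  qed
  have zero: "R j (e n) = 0" if "n < j" for j n
    using that
  proof (induction j)
    case (Suc j)
    then consider "n < j" | "n = j" by linarith
    then show ?case
      unfolding RS \<psi>_def pivot_def
      using Suc.IH positive_form.deflate(2,3)[OF pos[of j]] by cases auto
  qed simp
  have A: "A x = (\<Sum>j<k. cinner (\<psi> j) x *\<^sub>C \<psi> j) + R k x" for k x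
    by (induction k) (simp_all add: R0 RS)
  show ?thesis
  proof (rule that)
    show "cinner (\<psi> j) (e n) = 0" if "n < j" for j n
      using positive_form.deflate(4)[OF pos[of j] zero[OF that]] unfolding \<psi>_def pivot_def .
    show "A (e n) = (\<Sum>j\<le>n. cinner (\<psi> j) (e n) *\<^sub>C \<psi> j)" for n
      using A[of "e n" "Suc n"] zero[of n "Suc n"] by (simp add: lessThan_Suc_atMost)
  qed
qed

lemma q_zero [simp]: "q 0 = 0"
  using diff[of 0 0] by (simp add: q_def)

lemma q_scaleC: "q (a *\<^sub>C x) = (cmod a)\<^sup>2 * q x"
proof -
  have "cinner (a *\<^sub>C x) (A (a *\<^sub>C x)) = (a * cnj a) * cinner x (A x)"
    by (simp add: scale cinner_scaleC_left cinner_scaleC_right)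
  then show ?thesis
    unfolding mult_cnj_cmod cinner_q by (simp only: of_real_mult[symmetric] of_real_eq_iff)
qed

text \<open>With \<open>a = x - y\<close>, the right-hand side minus the left-hand side, multiplied
  by \<open>1 + c\<close>, equals \<open>q (a - c y)\<close>, a nonnegative number.\<close>

lemma q_filter:
  assumes "c \<ge> 0"
  shows "c / (1 + c) * q x \<le> q (x - y) + c * q y"
proof -
  define a where "a = x - y"
  have x: "x = a + y" by (simp add: a_def)
  have s: "q (a + y) = q a + q y + 2 * Re (cinner a (A y))"
    using cinner_swap[of a y] by (simp add: q_def add cinner_add_left cinner_add_right)
  have "0 \<le> q (a + of_real (- c) *\<^sub>C y)" by simp
  also have "\<dots> = q a + c\<^sup>2 * q y - 2 * c * Re (cinner a (A y))"
    using cinner_swap[of a y]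
    by (simp add: q_def add scale cinner_add_left cinner_add_right cinner_scaleC_left cinner_scaleC_right
      power2_eq_square algebra_simps)
  finally have "c * q (a + y) \<le> (1 + c) * (q a + c * q y)"
    unfolding s by (simp add: algebra_simps power2_eq_square)
  then show ?thesis using assms unfolding x by (simp add: pos_divide_le_eq mult.commute)
qed

text \<open>Cauchy-Schwarz with free weights. The induction adds one term and controls its cross
  term by the inequality of arithmetic and geometric means.\<close>

lemma q_sum_le:
  assumes "finite S" "\<And>n. n \<in> S \<Longrightarrow> s n > 0"
  shows "q (\<Sum>n\<in>S. a n *\<^sub>C f n) \<le> (\<Sum>n\<in>S. (cmod (a n))\<^sup>2 / s n) * (\<Sum>n\<in>S. s n * q (f n))"
  using assms
proof (induction S)
  case empty
  then show ?case by simp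
next
  case (insert m S)
  define y where "y = (\<Sum>n\<in>S. a n *\<^sub>C f n)"
  define z where "z = a m *\<^sub>C f m"
  define P Q p r where "P = (\<Sum>n\<in>S. (cmod (a n))\<^sup>2 / s n)" and "Q = (\<Sum>n\<in>S. s n * q (f n))"
    and "p = (cmod (a m))\<^sup>2 / s m" and "r = s m * q (f m)"
  have "s n \<ge> 0" if "n \<in> insert m S" for n using insert.prems[OF that] by simp
  then have nn: "P \<ge> 0" "Q \<ge> 0" "p \<ge> 0" "r \<ge> 0"
    unfolding P_def Q_def p_def r_def
    by (auto intro!: sum_nonneg divide_nonneg_nonneg mult_nonneg_nonneg)
  have y: "q y \<le> P * Q" unfolding y_def P_def Q_def using insert by simp
  have "q z = (cmod (a m))\<^sup>2 * q (f m)" unfolding z_def by (rule q_scaleC)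
  then have z: "q z = p * r"
    using insert.prems[of m] by (simp add: p_def r_def)
  have "(Re (cinner z (A y)))\<^sup>2 \<le> (cmod (cinner z (A y)))\<^sup>2"
    by (simp add: cmod_power2)
  also have "\<dots> \<le> q y * q z" by (rule Cauchy_Schwarz)
  also have "\<dots> \<le> (P * Q) * (p * r)" unfolding z using y nn by (intro mult_right_mono) auto
  also have "\<dots> \<le> ((p * Q + r * P) / 2)\<^sup>2"
  proof -
    have "0 \<le> (p * Q - r * P)\<^sup>2" by simp
    then show ?thesis by (simp add: power2_eq_square field_simps)
  qed
  finally have "Re (cinner z (A y)) \<le> (p * Q + r * P) / 2"
    by (rule power2_le_imp_le) (simp add: nn)
  moreover have "q (z + y) = q z + q y + 2 * Re (cinner z (A y))"
    using cinner_swap[of z y] by (simp add: q_def add cinner_add_left cinner_add_right)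
  ultimately have "q (z + y) \<le> (p + P) * (r + Q)"
    using y z by (simp add: algebra_simps)
  then show ?case
    using insert.hyps by (simp add: y_def z_def P_def Q_def p_def r_def)
qed

end

section \<open>Traces against a phase-shifted state as sums over its Cholesky factors\<close>

lemma positive_form_positive_operator:
  assumes "positive_operator A"
  shows "positive_form A"
  using assms unfolding positive_operator_def bounded_operator_def
  by (auto intro!: positive_form.intro simp: linear_add bounded_linear.linear)


text \<open>The double array \<open>b j n\<close> sums over \<open>n\<close> to
  \<open>\<langle>\<phi> j|A \<phi> j\<rangle>\<close> by Parseval, and over \<open>j\<close> to a
  diagonal entry of the trace, as a finite sum by triangularity. It is dominated by
  \<open>h\<close>, whose total is at most \<open>(1 + K^2) / 2\<close> times the sum of the squared
  norms, so both orders agree.\<close>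

lemma sums_op_trace_phase_shifted:
  fixes e :: "nat \<Rightarrow> 'h::complex_hilbert_space"
  assumes basis: "orthonormal_basis e"
    and \<rho>: "positive_operator \<rho>"
    and \<psi>: "\<And>j n. n < j \<Longrightarrow> cinner (\<psi> j) (e n) = 0"
      "\<And>n. \<rho> (e n) = (\<Sum>j\<le>n. cinner (\<psi> j) (e n) *\<^sub>C \<psi> j)"
    and summable: "summable (\<lambda>j. (norm (\<psi> j))\<^sup>2)"
    and A: "positive_operator A"
  shows "(\<lambda>j. Re (cinner (phase_op e \<theta> (\<psi> j)) (A (phase_op e \<theta> (\<psi> j)))))
    sums Re (op_trace e (phase_shifted e \<rho> \<theta> \<circ> A))"
proof -
  interpret \<rho>: positive_form \<rho> using \<rho> by (rule positive_form_positive_operator)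
  interpret A: positive_form A using A by (rule positive_form_positive_operator)
  define \<phi> where "\<phi> j = phase_op e \<theta> (\<psi> j)" for j
  define b where "b j n = cinner (A (\<phi> j)) (e n) * cinner (e n) (\<phi> j)" for j n
  define h where "h j n = ((cmod (cinner (e n) (\<phi> j)))\<^sup>2 + (cmod (cinner (e n) (A (\<phi> j))))\<^sup>2) / 2" for j n
  have \<phi>0: "cinner (e n) (\<phi> j) = 0" if "n < j" for j n
    using \<psi>(1)[OF that] cinner_commute[of "e n" "\<psi> j"] by (simp add: \<phi>_def cinner_basis_phase_op[OF basis])
  have norm_\<phi>: "norm (\<phi> j) = norm (\<psi> j)" for j
    by (simp add: \<phi>_def norm_phase_op[OF basis])
  have trace_term: "cinner (e n) ((phase_shifted e \<rho> \<theta> \<circ> A) (e n)) = (\<Sum>j\<le>n. b j n)" for n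
  proof -
    define \<omega> where "\<omega> = exp (- \<i> * of_nat n * of_real (- \<theta>))"
    have \<omega>: "cnj \<omega> = exp (- \<i> * of_nat n * of_real \<theta>)" by (simp add: \<omega>_def exp_cnj)
    have "cinner (e n) ((phase_shifted e \<rho> \<theta> \<circ> A) (e n))
        = cinner (phase_op e (- \<theta>) (e n)) (\<rho> (phase_op e (- \<theta>) (A (e n))))"
      using phase_op_adjoint[OF basis, of "e n" "- \<theta>" "\<rho> (phase_op e (- \<theta>) (A (e n)))"]
      by (simp add: phase_shifted_def)
    also have "\<dots> = cinner (\<omega> *\<^sub>C \<rho> (e n)) (phase_op e (- \<theta>) (A (e n)))"
      unfolding phase_op_basis[OF basis] \<omega>_def[symmetric] \<rho>.hermitian \<rho>.scale ..
    also have "\<dots> = (\<Sum>j\<le>n. cnj \<omega> * cnj (cinner (\<psi> j) (e n)) * cinner (\<phi> j) (A (e n)))"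
      by (simp only: \<psi>(2) cinner_scaleC_left cinner_sum_left sum_distrib_left \<phi>_def mult.assoc
          phase_op_adjoint[OF basis, symmetric])
    also have "\<dots> = (\<Sum>j\<le>n. b j n)"
    proof (rule sum.cong[OF refl])
      fix j
      have "cnj \<omega> * cnj (cinner (\<psi> j) (e n)) = cinner (e n) (\<phi> j)"
        unfolding \<phi>_def cinner_basis_phase_op[OF basis] \<omega> cinner_commute[of "e n" "\<psi> j"] ..
      then show "cnj \<omega> * cnj (cinner (\<psi> j) (e n)) * cinner (\<phi> j) (A (e n)) = b j n"
        by (simp add: b_def A.hermitian mult.commute)
    qed
    finally show ?thesis .
  qed
  obtain K where K: "\<And>x. norm (A x) \<le> norm x * K"
    using A bounded_linear.bounded unfolding positive_operator_def bounded_operator_def by blast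
  have h_sums: "(\<lambda>n. h j n) sums (((norm (\<phi> j))\<^sup>2 + (norm (A (\<phi> j)))\<^sup>2) / 2)" for j
    unfolding h_def by (intro sums_divide sums_add basis_norm_sums[OF basis])
  have h_nonneg: "h j n \<ge> 0" for j n by (simp add: h_def)
  have "((\<lambda>n. case (j, n) of (j, n) \<Rightarrow> h j n) has_sum (((norm (\<phi> j))\<^sup>2 + (norm (A (\<phi> j)))\<^sup>2) / 2)) UNIV" for j
    using norm_summable_imp_has_sum[OF _ h_sums[of j]] sums_summable[OF h_sums[of j]] h_nonneg by simp
  moreover have "(\<lambda>j. ((norm (\<phi> j))\<^sup>2 + (norm (A (\<phi> j)))\<^sup>2) / 2) summable_on UNIV"
  proof -
    have "norm (((norm (\<phi> j))\<^sup>2 + (norm (A (\<phi> j)))\<^sup>2) / 2) \<le> (1 + K\<^sup>2) / 2 * (norm (\<psi> j))\<^sup>2" for j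
      using power_mono[OF K[of "\<phi> j"] norm_ge_zero, of 2]
      by (simp add: norm_\<phi> power_mult_distrib algebra_simps)
    then have "Series.summable (\<lambda>j. norm (((norm (\<phi> j))\<^sup>2 + (norm (A (\<phi> j)))\<^sup>2) / 2))"
      by (intro summable_comparison_test'[OF summable_mult[OF summable, of "(1 + K\<^sup>2) / 2"]]) simp
    then show ?thesis by (rule norm_summable_imp_summable_on)
  qed
  ultimately have h_summable: "(\<lambda>(j, n). h j n) summable_on (UNIV \<times> UNIV)"
    by (rule summable_on_SigmaI) (use h_nonneg in auto)
  have b_le: "cmod (b j n) \<le> h j n" for j n
  proof -
    have "cmod (cinner (A (\<phi> j)) (e n)) = cmod (cinner (e n) (A (\<phi> j)))"
      using cinner_commute[of "A (\<phi> j)" "e n"] by simp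
    moreover have "x * y \<le> (y\<^sup>2 + x\<^sup>2) / 2" for x y :: real
      using sum_squares_bound[of x y] by simp
    ultimately show ?thesis by (simp add: b_def h_def norm_mult)
  qed
  have "(\<lambda>x. norm (case x of (j, n) \<Rightarrow> b j n)) summable_on (UNIV \<times> UNIV)"
    by (rule summable_on_comparison_test[OF h_summable]) (use b_le in auto)
  then have b_summable: "(\<lambda>(j, n). b j n) summable_on (UNIV \<times> UNIV)"
    by (rule abs_summable_summable)
  then obtain S where S: "((\<lambda>(j, n). b j n) has_sum S) (UNIV \<times> UNIV)"
    unfolding summable_on_def by blast
  have "((\<lambda>j. cinner (\<phi> j) (A (\<phi> j))) has_sum S) UNIV"
  proof (rule has_sum_SigmaD[OF S])
    fix j
    have "Series.summable (\<lambda>n. norm (b j n))"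
      by (rule summable_comparison_test'[OF sums_summable[OF h_sums[of j]]]) (simp add: b_le)
    moreover have "(\<lambda>n. b j n) sums cinner (\<phi> j) (A (\<phi> j))"
      unfolding b_def A.hermitian by (rule basis_Parseval[OF basis])
    ultimately show "((\<lambda>n. case (j, n) of (j, n) \<Rightarrow> b j n) has_sum cinner (\<phi> j) (A (\<phi> j))) UNIV"
      by (simp add: norm_summable_imp_has_sum)
  qed
  then have "(\<lambda>j. Re (cinner (\<phi> j) (A (\<phi> j)))) sums Re S"
    by (intro sums_Re has_sum_imp_sums)
  moreover have "((\<lambda>n. \<Sum>j\<le>n. b j n) has_sum S) UNIV"
  proof (rule has_sum_SigmaD)
    show "((\<lambda>(n, j). b j n) has_sum S) (UNIV \<times> UNIV)"
      using S by (subst has_sum_swap) simp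
    fix n
    show "((\<lambda>j. case (n, j) of (n, j) \<Rightarrow> b j n) has_sum (\<Sum>j\<le>n. b j n)) UNIV"
      by (rule has_sum_finite_neutralI[of "{..n}"]) (auto simp: b_def \<phi>0)
  qed
  then have "op_trace e (phase_shifted e \<rho> \<theta> \<circ> A) = S"
    unfolding op_trace_def trace_term by (intro sums_unique[symmetric] has_sum_imp_sums)
  ultimately show ?thesis by (simp add: \<phi>_def)
qed

lemma suminf_ennreal_swap:
  fixes f :: "nat \<Rightarrow> nat \<Rightarrow> ennreal"
  shows "(\<Sum>i. \<Sum>j. f i j) = (\<Sum>j. \<Sum>i. f i j)"
  using nn_integral_suminf[of "\<lambda>j i. f i j" "count_space UNIV"]
  by (simp add: nn_integral_count_space_nat)

lemma suminf_ennreal_imp_sums: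
  assumes "\<And>n. f n \<ge> 0" "(\<Sum>n. ennreal (f n)) = ennreal a" "a \<ge> 0"
  shows "f sums a"
proof -
  have summable: "summable f"
    using assms by (intro summable_suminf_not_top) auto
  have "ennreal (\<Sum>n. f n) = ennreal a"
    using suminf_ennreal2[OF assms(1) summable] assms(2) by simp
  then have "(\<Sum>n. f n) = a"
    using ennreal_inj[OF suminf_nonneg[OF summable assms(1)] assms(3)] by simp
  then show ?thesis using summable_sums[OF summable] by simp
qed

text \<open>Exchanging the two summations of the squared coefficients of the factors turns the unit
  trace into the total squared norm 1.\<close>

lemma density_operator_cholesky:
  fixes e :: "nat \<Rightarrow> 'h::complex_hilbert_space"
  assumes basis: "orthonormal_basis e" and \<rho>: "density_operator e \<rho>"
  obtains \<psi> where "\<And>j n. n < j \<Longrightarrow> cinner (\<psi> j) (e n) = 0"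
    and "\<And>n. \<rho> (e n) = (\<Sum>j\<le>n. cinner (\<psi> j) (e n) *\<^sub>C \<psi> j)"
    and "\<And>n. ennreal (Re (cinner (e n) (\<rho> (e n)))) = (\<Sum>j. ennreal ((cmod (cinner (e n) (\<psi> j)))\<^sup>2))"
    and "(\<lambda>j. (norm (\<psi> j))\<^sup>2) sums 1"
proof -
  interpret positive_form \<rho>
    using \<rho> unfolding density_operator_def by (intro positive_form_positive_operator) blast
  obtain \<psi> where \<psi>: "\<And>j n. n < j \<Longrightarrow> cinner (\<psi> j) (e n) = 0"
    "\<And>n. \<rho> (e n) = (\<Sum>j\<le>n. cinner (\<psi> j) (e n) *\<^sub>C \<psi> j)"
    using cholesky[of e] by blast
  have c: "cmod (cinner (\<psi> j) (e n)) = cmod (cinner (e n) (\<psi> j))" for j n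
    using cinner_commute[of "\<psi> j" "e n"] by simp
  have z: "cinner (e n) (\<psi> j) = 0" if "n < j" for j n
    using c[of j n] \<psi>(1)[OF that] by simp
  have q: "ennreal (Re (cinner (e n) (\<rho> (e n)))) = (\<Sum>j. ennreal ((cmod (cinner (e n) (\<psi> j)))\<^sup>2))" for n
  proof -
    have "cinner (e n) (\<rho> (e n)) = (\<Sum>j\<le>n. of_real ((cmod (cinner (e n) (\<psi> j)))\<^sup>2))"
      unfolding \<psi>(2) cinner_sum_right cinner_scaleC_right
      by (intro sum.cong refl) (use cinner_commute[of _ "e n"] in \<open>metis mult_cnj_cmod mult.commute\<close>)
    then have "ennreal (Re (cinner (e n) (\<rho> (e n)))) = (\<Sum>j\<le>n. ennreal ((cmod (cinner (e n) (\<psi> j)))\<^sup>2))"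
      by (simp add: sum_ennreal)
    also have "\<dots> = (\<Sum>j. ennreal ((cmod (cinner (e n) (\<psi> j)))\<^sup>2))"
      using z by (intro suminf_finite[symmetric]) (auto simp: not_le)
    finally show ?thesis .
  qed
  have norm: "(\<Sum>n. ennreal ((cmod (cinner (e n) (\<psi> j)))\<^sup>2)) = ennreal ((norm (\<psi> j))\<^sup>2)" for j
    using basis_norm_sums[OF basis] by (intro suminf_ennreal_eq) auto
  have "(\<lambda>n. Re (cinner (e n) (\<rho> (e n)))) sums 1"
    using \<rho> sums_Re[OF summable_sums] unfolding density_operator_def op_trace_def by (metis one_complex.sel(1))
  then have "1 = (\<Sum>n. ennreal (Re (cinner (e n) (\<rho> (e n)))))"
    using q_nonneg by (subst suminf_ennreal_eq) (auto simp: q_def)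
  also have "\<dots> = (\<Sum>j. ennreal ((norm (\<psi> j))\<^sup>2))"
    unfolding q by (subst suminf_ennreal_swap) (simp add: norm)
  finally have s: "(\<Sum>j. ennreal ((norm (\<psi> j))\<^sup>2)) = 1" ..
  then have "(\<lambda>j. (norm (\<psi> j))\<^sup>2) sums 1"
    by (intro suminf_ennreal_imp_sums) simp_all
  then show ?thesis using that[of \<psi>] \<psi> q by blast
qed


section \<open>Angles and integrals\<close>

text \<open>\<open>Arg\<close> is continuous off the nonpositive real axis, equals \<open>pi\<close>
  on the negative axis and has the conventional value 0 at 0.\<close>

lemma borel_measurable_Arg [measurable]: "Arg \<in> borel_measurable borel"
proof -
  have cont: "(\<lambda>z. indicat_real (- \<real>\<^sub>\<le>\<^sub>0) z *\<^sub>R Arg z) \<in> borel_measurable borel"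
    by (intro borel_measurable_continuous_on_indicator continuous_on_Arg) auto
  have "(\<lambda>z. if z \<in> \<real>\<^sub>\<le>\<^sub>0 then pi else indicat_real (- \<real>\<^sub>\<le>\<^sub>0) z *\<^sub>R Arg z) \<in> borel_measurable borel"
    (is "?f \<in> _") by (rule measurable_If_set[OF _ cont]) auto
  then have "(\<lambda>z. if z = 0 then 0 else ?f z) \<in> borel_measurable borel" by measurable
  also have "(\<lambda>z. if z = 0 then 0 else ?f z) = Arg"
    by (auto simp: fun_eq_iff nonpos_Reals_def Arg_zero Arg_of_real)
  finally show ?thesis .
qed

lemma borel_measurable_reduce_angle [measurable]: "reduce_angle \<in> borel_measurable borel"
  unfolding reduce_angle_def[abs_def] by measurable

lemma reduce_angle_bounds: "- pi \<le> reduce_angle t" "reduce_angle t < pi"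
proof -
  let ?k = "\<lfloor>(t + pi) / (2 * pi)\<rfloor>"
  have two: "2 * pi > 0" by simp
  have "of_int ?k \<le> (t + pi) / (2 * pi)" "(t + pi) / (2 * pi) < of_int ?k + 1"
    by linarith+
  then have "of_int ?k * (2 * pi) \<le> t + pi" "t + pi < (of_int ?k + 1) * (2 * pi)"
    by (simp_all only: pos_le_divide_eq[OF two, symmetric] pos_divide_less_eq[OF two, symmetric])
  then show "- pi \<le> reduce_angle t" "reduce_angle t < pi"
    unfolding reduce_angle_def by (simp_all add: algebra_simps)
qed

lemma reduce_angle_eq:
  assumes "- pi \<le> t - 2 * pi * of_int k" "t - 2 * pi * of_int k < pi"
  shows "reduce_angle t = t - 2 * pi * of_int k"
proof -
  have "\<lfloor>(t + pi) / (2 * pi)\<rfloor> = k"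
    by (rule floor_unique) (use assms in \<open>simp_all add: pos_le_divide_eq pos_divide_less_eq algebra_simps\<close>)
  then show ?thesis by (simp add: reduce_angle_def)
qed

text \<open>As \<open>\<theta>\<close> runs through a period, the reduced error runs through \<open>[-pi, pi)\<close> in two pieces.\<close>

lemma nn_integral_period_reduce_angle_le:
  fixes f :: "real \<Rightarrow> ennreal"
  assumes f [measurable]: "f \<in> borel_measurable borel"
  shows "(\<integral>\<^sup>+\<theta>. f (reduce_angle (a - \<theta>)) * indicator {c..<c + 2 * pi} \<theta> \<partial>lborel) \<le> (\<integral>\<^sup>+x. f x \<partial>lborel)"
proof -
  define k where "k = \<lfloor>(a - c + pi) / (2 * pi)\<rfloor>"
  define d where "d = a - c - 2 * pi * of_int k"
  have d: "- pi \<le> d" "d < pi"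
    using reduce_angle_bounds[of "a - c"] unfolding reduce_angle_def d_def k_def by simp_all
  \<comment> \<open>\<open>d\<close> is the reduced error at the left end of the period. As \<theta>
    grows, the error falls from \<open>d\<close> to \<open>-pi\<close>, jumps to \<open>pi\<close>
    and falls towards \<open>d\<close>: \<open>g\<close> collects the first piece and
    \<open>h\<close> the second.\<close>
  define g where "g = (\<lambda>x. f x * indicator {..d} x)"
  define h where "h = (\<lambda>x. f x * indicator {d<..} x)"
  have [measurable]: "g \<in> borel_measurable borel" "h \<in> borel_measurable borel"
    unfolding g_def h_def by measurable
  have "f (reduce_angle (a - \<theta>)) * indicator {c..<c + 2 * pi} \<theta>
    \<le> g (a - 2 * pi * of_int k + (- 1) * \<theta>) + h (a - 2 * pi * of_int k + 2 * pi + (- 1) * \<theta>)" for \<theta>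
  proof (cases "\<theta> \<in> {c..<c + 2 * pi}")
    case True
    define x where "x = a - \<theta> - 2 * pi * of_int k"
    have x: "d - 2 * pi < x" "x \<le> d" using True by (auto simp: x_def d_def)
    have e: "a - 2 * pi * of_int k + (- 1) * \<theta> = x" "a - 2 * pi * of_int k + 2 * pi + (- 1) * \<theta> = x + 2 * pi"
      by (simp_all add: x_def)
    show ?thesis
    proof (cases "- pi \<le> x")
      case True
      then have "reduce_angle (a - \<theta>) = x"
        using x d unfolding x_def by (intro reduce_angle_eq) auto
      then show ?thesis unfolding e using x by (simp add: g_def indicator_def)
    next
      case False
      then have "reduce_angle (a - \<theta>) = a - \<theta> - 2 * pi * of_int (k - 1)"
        using x d unfolding x_def by (intro reduce_angle_eq) (auto simp: algebra_simps)
      also have "\<dots> = x + 2 * pi" by (simp add: x_def algebra_simps)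
      finally have "reduce_angle (a - \<theta>) = x + 2 * pi" .
      then show ?thesis unfolding e using x by (simp add: h_def indicator_def)
    qed
  qed simp
  then have "(\<integral>\<^sup>+\<theta>. f (reduce_angle (a - \<theta>)) * indicator {c..<c + 2 * pi} \<theta> \<partial>lborel)
    \<le> (\<integral>\<^sup>+\<theta>. g (a - 2 * pi * of_int k + (- 1) * \<theta>) + h (a - 2 * pi * of_int k + 2 * pi + (- 1) * \<theta>) \<partial>lborel)"
    by (intro nn_integral_mono)
  also have "\<dots> = (\<integral>\<^sup>+x. g x \<partial>lborel) + (\<integral>\<^sup>+x. h x \<partial>lborel)"
    by (subst nn_integral_add, measurable)
      (simp add: nn_integral_real_affine[of g "- 1" "a - 2 * pi * of_int k"]
        nn_integral_real_affine[of h "- 1" "a - 2 * pi * of_int k + 2 * pi"])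
  also have "\<dots> = (\<integral>\<^sup>+x. g x + h x \<partial>lborel)"
    by (rule nn_integral_add[symmetric]) auto
  also have "\<dots> = (\<integral>\<^sup>+x. f x \<partial>lborel)"
    by (intro nn_integral_cong) (auto simp: g_def h_def indicator_def)
  finally show ?thesis .
qed

text \<open>An interval of length at most \<open>2 * pi\<close> lies in the closed period starting
  at its infimum; the right end point is a null set.\<close>

lemma nn_integral_interval_reduce_angle_le:
  fixes f :: "real \<Rightarrow> ennreal"
  assumes f [measurable]: "f \<in> borel_measurable borel"
    and I: "is_interval I" "emeasure lborel I = ennreal L" "L \<le> 2 * pi" "0 < L"
  shows "(\<integral>\<^sup>+\<theta>. f (reduce_angle (a - \<theta>)) * indicator I \<theta> \<partial>lborel) \<le> (\<integral>\<^sup>+x. f x \<partial>lborel)"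
proof -
  have len: "y - x \<le> L" if "x \<in> I" "y \<in> I" for x y
  proof (cases "x \<le> y")
    case True
    have "{x..y} \<subseteq> I" using mem_is_interval_1_I[OF I(1) that] by auto
    then have "emeasure lborel {x..y} \<le> ennreal L"
      unfolding I(2)[symmetric] using I(1) by (intro emeasure_mono) (auto simp: real_interval_borel_measurable)
    then show ?thesis using True I(4) by simp
  qed (use I(4) in auto)
  have "I \<noteq> {}" using I by auto
  then obtain x0 where x0: "x0 \<in> I" by blast
  have bdd: "bdd_below I"
    using len[OF _ x0] by (intro bdd_belowI[of _ "x0 - L"]) (simp add: algebra_simps)
  define c where "c = Inf I"
  have "c \<le> y" if "y \<in> I" for y unfolding c_def using that bdd by (rule cInf_lower)
  moreover have "y \<le> c + 2 * pi" if "y \<in> I" for y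
  proof -
    have "y - L \<le> c" unfolding c_def
      using len[OF _ that] \<open>I \<noteq> {}\<close> by (intro cInf_greatest) (auto simp: algebra_simps)
    then show ?thesis using I(3) by simp
  qed
  ultimately have sub: "I \<subseteq> {c..c + 2 * pi}" by auto
  have "(\<integral>\<^sup>+\<theta>. f (reduce_angle (a - \<theta>)) * indicator I \<theta> \<partial>lborel)
    \<le> (\<integral>\<^sup>+\<theta>. f (reduce_angle (a - \<theta>)) * indicator {c..<c + 2 * pi} \<theta> \<partial>lborel)"
    using AE_lborel_singleton[of "c + 2 * pi"] sub
    by (intro nn_integral_mono_AE) (auto simp: indicator_def elim!: eventually_mono)
  also have "\<dots> \<le> (\<integral>\<^sup>+x. f x \<partial>lborel)" by (rule nn_integral_period_reduce_angle_le[OF f])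
  finally show ?thesis .
qed

text \<open>The shape is chosen so that \<open>bump x / (1 + bump x)\<close> is a truncated parabola.\<close>

definition bump :: "real \<Rightarrow> real" where
  "bump x = max 0 (5 / (1 + 4 * x\<^sup>2) - 1)"

lemma bump_nonneg [simp]: "bump x \<ge> 0"
  by (simp add: bump_def)

lemma borel_measurable_bump [measurable]: "bump \<in> borel_measurable borel"
  unfolding bump_def[abs_def] by measurable

lemma bump_filter_ge: "4/5 * (1 - x\<^sup>2) \<le> bump x / (1 + bump x)"
proof (cases "x\<^sup>2 \<le> 1")
  case True
  have d: "1 + 4 * x\<^sup>2 > 0" by (simp add: add_pos_nonneg)
  then have b: "bump x = 5 / (1 + 4 * x\<^sup>2) - 1" using True by (simp add: bump_def field_simps)
  have "c / (1 + c) = 1 - 1 / (1 + c)" if "c \<ge> 0" for c :: real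
    using that by (simp add: field_simps)
  then have "bump x / (1 + bump x) = 1 - 1 / (1 + bump x)" by simp
  also have "\<dots> = 4/5 * (1 - x\<^sup>2)" unfolding b using d by (simp add: field_simps)
  finally show ?thesis by simp
next
  case False
  then have "4/5 * (1 - x\<^sup>2) \<le> 0" by simp
  also have "0 \<le> bump x / (1 + bump x)" by simp
  finally show ?thesis .
qed

text \<open>The bump has integral \<open>5 * arctan 2 - 2\<close>, and 1.12 is the value that makes
  this 18/5.\<close>

lemma arctan_2_le: "arctan (2::real) \<le> 1.12"
proof -
  have "arctan (1/2) = pi/2 - arctan (2::real)" using Transcendental.arctan_inverse[of 2] by simp
  moreover have "1/2 - 1/24 \<le> arctan (1/2::real)"
    using arctan_lower_bound[of "1/2" 1] by (simp add: eval_nat_numeral)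
  ultimately show ?thesis using pi_approx(2) by simp
qed

lemma nn_integral_bump: "(\<integral>\<^sup>+x. ennreal (bump x) \<partial>lborel) \<le> ennreal (18/5)"
proof -
  have "(\<integral>\<^sup>+x. ennreal (bump x) \<partial>lborel) = (\<integral>\<^sup>+x. ennreal (5 / (1 + 4 * x\<^sup>2) - 1) * indicator {-1..1} x \<partial>lborel)"
  proof (intro nn_integral_cong)
    fix x :: real
    have d: "1 + 4 * x\<^sup>2 > 0" by (simp add: add_pos_nonneg)
    show "ennreal (bump x) = ennreal (5 / (1 + 4 * x\<^sup>2) - 1) * indicator {-1..1} x"
    proof (cases "x \<in> {-1..1}")
      case True
      then have "x\<^sup>2 \<le> 1" by (simp add: abs_square_le_1 abs_le_iff)
      then show ?thesis using True d by (simp add: bump_def max_def field_simps)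
    next
      case False
      then have "x\<^sup>2 \<ge> 1" using abs_square_le_1[of x] by (force simp: abs_le_iff)
      then have "bump x = 0" using d by (simp add: bump_def max_def field_simps)
      then show ?thesis using False by simp
    qed
  qed
  also have "\<dots> = ennreal ((5/2 * arctan (2 * 1) - 1) - (5/2 * arctan (2 * (-1)) - (-1)))"
  proof (rule nn_integral_FTC_Icc)
    fix x :: real assume x: "x \<in> {-1..1}"
    have d: "1 + 4 * x\<^sup>2 > 0" by (simp add: add_pos_nonneg)
    show "((\<lambda>x. 5/2 * arctan (2 * x) - x) has_real_derivative 5 / (1 + 4 * x\<^sup>2) - 1) (at x)"
      by (rule derivative_eq_intros refl | simp add: power_mult_distrib field_simps)+
    have "x\<^sup>2 \<le> 1" using x by (simp add: abs_square_le_1 abs_le_iff)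
    then show "0 \<le> 5 / (1 + 4 * x\<^sup>2) - 1" using d by (simp add: field_simps)
  qed auto
  also have "\<dots> \<le> ennreal (18/5)"
    using arctan_2_le by (intro ennreal_leI) (simp add: arctan_minus)
  finally show ?thesis .
qed

lemma nn_integral_bump_scaled:
  assumes "r > 0"
  shows "(\<integral>\<^sup>+x. ennreal (bump (x / r)) \<partial>lborel) \<le> ennreal (r * (18/5))"
proof -
  have "(\<integral>\<^sup>+x. ennreal (bump (x / r)) \<partial>lborel) = ennreal r * (\<integral>\<^sup>+x. ennreal (bump x) \<partial>lborel)"
    using assms by (subst nn_integral_real_affine[of _ r 0]) auto
  also have "\<dots> \<le> ennreal r * ennreal (18/5)"
    by (intro mult_left_mono nn_integral_bump) auto
  also have "\<dots> = ennreal (r * (18/5))" using assms by (intro ennreal_mult[symmetric]) auto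
  finally show ?thesis .
qed

text \<open>The set inequality may be used with a different \<open>c\<close> on each level set of a
  simple function. The level sets partition the space, so the \<open>M1\<close> terms add up to its
  total mass. Monotone convergence, with \<open>t / (1 + t)\<close> increasing, extends this to
  \<open>v\<close>.\<close>

lemma nn_integral_filter_le:
  fixes v :: "'a \<Rightarrow> real"
  assumes sets: "sets M1 = sets M0" "sets M2 = sets M0"
    and v [measurable]: "v \<in> borel_measurable M0" and v0: "\<And>x. v x \<ge> 0"
    and le: "\<And>B c. B \<in> sets M0 \<Longrightarrow> c \<ge> 0 \<Longrightarrow>
      ennreal (c / (1 + c)) * emeasure M0 B \<le> emeasure M1 B + ennreal c * emeasure M2 B"
  shows "(\<integral>\<^sup>+x. ennreal (v x / (1 + v x)) \<partial>M0) \<le> emeasure M1 (space M1) + (\<integral>\<^sup>+x. ennreal (v x) \<partial>M2)"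
proof -
  have space: "space M1 = space M0" "space M2 = space M0"
    using sets by (auto dest: sets_eq_imp_space_eq)
  have simple: "(\<integral>\<^sup>+x. ennreal (s x / (1 + s x)) \<partial>M0) \<le> emeasure M1 (space M1) + (\<integral>\<^sup>+x. ennreal (s x) \<partial>M2)"
    if s: "simple_function M0 s" and s0: "\<And>x. s x \<ge> 0" for s :: "'a \<Rightarrow> real"
  proof -
    let ?Y = "s ` space M0" and ?B = "\<lambda>y. s -` {y} \<inter> space M0"
    have fin: "finite ?Y" and B: "\<And>y. ?B y \<in> sets M0"
      using s simple_functionD[OF s] by auto
    have expand: "ennreal (h (s x)) = (\<Sum>y\<in>?Y. ennreal (h y) * indicator (?B y) x)"
      if "x \<in> space M0" for h x
    proof -
      have "(\<Sum>y\<in>?Y. ennreal (h y) * indicator (?B y) x) = (\<Sum>y\<in>?Y. if y = s x then ennreal (h y) else 0)"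
        using that by (intro sum.cong) (auto simp: indicator_def)
      then show ?thesis using that fin by simp
    qed
    have "(\<integral>\<^sup>+x. ennreal (s x / (1 + s x)) \<partial>M0)
        = (\<integral>\<^sup>+x. (\<Sum>y\<in>?Y. ennreal (y / (1 + y)) * indicator (?B y) x) \<partial>M0)"
      by (intro nn_integral_cong expand)
    also have "\<dots> = (\<Sum>y\<in>?Y. ennreal (y / (1 + y)) * emeasure M0 (?B y))"
      using B by (subst nn_integral_sum) (auto simp: nn_integral_cmult_indicator)
    also have "\<dots> \<le> (\<Sum>y\<in>?Y. emeasure M1 (?B y) + ennreal y * emeasure M2 (?B y))"
      using B s0 by (intro sum_mono le) auto
    also have "\<dots> = (\<Sum>y\<in>?Y. emeasure M1 (?B y)) + (\<Sum>y\<in>?Y. ennreal y * emeasure M2 (?B y))"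
      by (rule sum.distrib)
    also have "(\<Sum>y\<in>?Y. emeasure M1 (?B y)) = emeasure M1 (\<Union>y\<in>?Y. ?B y)"
      using fin B sets by (intro sum_emeasure) (auto simp: disjoint_family_on_def)
    also have "(\<Union>y\<in>?Y. ?B y) = space M1"
      by (auto simp: space)
    also have "(\<Sum>y\<in>?Y. ennreal y * emeasure M2 (?B y)) = (\<integral>\<^sup>+x. (\<Sum>y\<in>?Y. ennreal y * indicator (?B y) x) \<partial>M2)"
      using B sets by (subst nn_integral_sum) (auto simp: nn_integral_cmult_indicator)
    also have "\<dots> = (\<integral>\<^sup>+x. ennreal (s x) \<partial>M2)"
      using expand[of _ "\<lambda>y. y"] by (intro nn_integral_cong) (simp add: space)
    finally show ?thesis .
  qed
  obtain s where s: "incseq s" "\<And>i. simple_function M0 (s i)" "\<And>i x. 0 \<le> s i x"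
    "\<And>x. bdd_above (range (\<lambda>i. s i x))" "v = (SUP i. s i)"
    using borel_measurable_implies_simple_function_sequence_real[OF v v0] by metis
  have mono: "s i x \<le> s j x" if "i \<le> j" for i j x
    using s(1) that by (simp add: incseq_def le_fun_def)
  have v_SUP: "v x = (SUP i. s i x)" for x
    unfolding s(5) by (simp add: image_image)
  have s_le: "s i x \<le> v x" for i x
    unfolding v_SUP using s(4) by (intro cSUP_upper) auto
  have "(\<lambda>i. s i x) \<longlonglongrightarrow> v x" for x
    unfolding v_SUP using s(4) mono by (intro LIMSEQ_incseq_SUP) (auto simp: incseq_def)
  then have lim: "(\<lambda>i. ennreal (s i x / (1 + s i x))) \<longlonglongrightarrow> ennreal (v x / (1 + v x))" for x
    using v0[of x] by (intro tendsto_ennrealI tendsto_divide tendsto_add tendsto_const) auto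
  have inc: "incseq (\<lambda>i x. ennreal (s i x / (1 + s i x)))"
  proof (intro incseq_SucI le_funI ennreal_leI)
    fix i x
    have "a / (1 + a) \<le> b / (1 + b)" if "0 \<le> a" "a \<le> b" for a b :: real
      using that by (simp add: divide_simps algebra_simps)
    then show "s i x / (1 + s i x) \<le> s (Suc i) x / (1 + s (Suc i) x)"
      using s(3) mono[of i "Suc i" x] by simp
  qed
  have "(SUP i. ennreal (s i x / (1 + s i x))) = ennreal (v x / (1 + v x))" for x
    using inc by (intro LIMSEQ_unique[OF LIMSEQ_SUP lim]) (auto simp: incseq_def le_fun_def)
  then have "(\<integral>\<^sup>+x. ennreal (v x / (1 + v x)) \<partial>M0) = (\<integral>\<^sup>+x. (SUP i. ennreal (s i x / (1 + s i x))) \<partial>M0)"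
    by simp
  also have "\<dots> = (SUP i. \<integral>\<^sup>+x. ennreal (s i x / (1 + s i x)) \<partial>M0)"
  proof (rule nn_integral_monotone_convergence_SUP[OF inc])
    fix i
    have [measurable]: "s i \<in> borel_measurable M0"
      using s(2) by (rule borel_measurable_simple_function)
    show "(\<lambda>x. ennreal (s i x / (1 + s i x))) \<in> borel_measurable M0" by measurable
  qed
  also have "\<dots> \<le> emeasure M1 (space M1) + (\<integral>\<^sup>+x. ennreal (v x) \<partial>M2)"
  proof (rule SUP_least)
    fix i
    have "(\<integral>\<^sup>+x. ennreal (s i x / (1 + s i x)) \<partial>M0) \<le> emeasure M1 (space M1) + (\<integral>\<^sup>+x. ennreal (s i x) \<partial>M2)"
      by (rule simple[OF s(2,3)])
    also have "\<dots> \<le> emeasure M1 (space M1) + (\<integral>\<^sup>+x. ennreal (v x) \<partial>M2)"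
      by (intro add_left_mono nn_integral_mono ennreal_leI s_le)
    finally show "(\<integral>\<^sup>+x. ennreal (s i x / (1 + s i x)) \<partial>M0) \<le> emeasure M1 (space M1) + (\<integral>\<^sup>+x. ennreal (v x) \<partial>M2)" .
  qed
  finally show ?thesis .
qed


section \<open>Outcome laws of mixtures\<close>

lemma sigma_algebra_circle: "sigma_algebra circle circle_sets"
  unfolding circle_sets_def using sets.sigma_algebra_axioms[of "restrict_space borel circle"]
  by (simp add: space_restrict_space)

lemma circle_sets_subset: "circle_sets \<subseteq> Pow circle"
  using sets.space_closed[of "restrict_space borel circle"]
  by (simp add: circle_sets_def space_restrict_space)

lemma circle_in_circle_sets [simp]: "circle \<in> circle_sets"
  using sigma_algebra_circle by (simp add: sigma_algebra_def algebra.top)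

text \<open>The outcome law of the unnormalised mixture \<open>\<Sum>j. |x j\<rangle>\<langle>x j|\<close>.\<close>

definition ensemble_law ::
    "(complex set \<Rightarrow> 'h::complex_hilbert_space \<Rightarrow> 'h) \<Rightarrow> (nat \<Rightarrow> 'h) \<Rightarrow> complex measure" where
  "ensemble_law M x = measure_of circle circle_sets (\<lambda>B. \<Sum>j. ennreal (Re (cinner (x j) (M B (x j)))))"

lemma sets_ensemble_law [simp]: "sets (ensemble_law M x) = circle_sets"
  unfolding ensemble_law_def
  using circle_sets_subset sigma_algebra.sigma_sets_eq[OF sigma_algebra_circle] by (simp add: sets_measure_of)

lemma space_ensemble_law [simp]: "space (ensemble_law M x) = circle"
  unfolding ensemble_law_def using circle_sets_subset by (simp add: space_measure_of)

lemma borel_measurable_ensemble_law: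
  assumes "f \<in> borel_measurable borel"
  shows "f \<in> borel_measurable (ensemble_law M x)"
proof -
  have "f \<in> borel_measurable (restrict_space borel circle)"
    using assms by (rule measurable_restrict_space1)
  then show ?thesis
    by (subst measurable_cong_sets[of _ "restrict_space borel circle"]) (auto simp: circle_sets_def)
qed

context
  fixes M :: "complex set \<Rightarrow> 'h::complex_hilbert_space \<Rightarrow> 'h"
  assumes povm: "povm_on_circle M"
begin

lemma povm_positive_form: "B \<in> circle_sets \<Longrightarrow> positive_form (M B)"
  using povm unfolding povm_on_circle_def by (blast intro: positive_form_positive_operator)

text \<open>\<open>measure_of\<close> yields the zero measure for a set function that is not a
  measure, so countable additivity has to be shown before any value is known. It is an interchange
  of two nonnegative series.\<close>

lemma emeasure_ensemble_law:
  assumes "B \<in> circle_sets"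
  shows "emeasure (ensemble_law M x) B = (\<Sum>j. ennreal (Re (cinner (x j) (M B (x j)))))"
  unfolding ensemble_law_def
proof (rule emeasure_measure_of_sigma[OF sigma_algebra_circle _ _ assms])
  have empty: "{} \<in> circle_sets" by (simp add: circle_sets_def)
  have add: "(\<lambda>i. cinner y (M (B i) y)) sums cinner y (M (\<Union>i. B i) y)"
    if "range B \<subseteq> circle_sets" "disjoint_family B" for B y
    using povm that unfolding povm_on_circle_def by blast
  \<comment> \<open>Additivity on the constant sequence of empty sets gives a convergent constant
    series, hence the value 0.\<close>
  have "cinner y (M {} y) = 0" for y
  proof -
    have "(\<lambda>i::nat. cinner y (M {} y)) sums cinner y (M (\<Union>i::nat. {}) y)"
      using add[of "\<lambda>_. {}" y] empty by (simp add: disjoint_family_on_def)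
    then show ?thesis using sums_summable summable_const_iff by blast
  qed
  then show "positive circle_sets (\<lambda>B. \<Sum>j. ennreal (Re (cinner (x j) (M B (x j)))))"
    by (simp add: positive_def)
  show "countably_additive circle_sets (\<lambda>B. \<Sum>j. ennreal (Re (cinner (x j) (M B (x j)))))"
  proof (rule countably_additiveI)
    fix B :: "nat \<Rightarrow> complex set"
    assume B: "range B \<subseteq> circle_sets" "disjoint_family B"
    have "(\<Sum>i. ennreal (Re (cinner y (M (B i) y)))) = ennreal (Re (cinner y (M (\<Union>i. B i) y)))" for y
    proof (rule suminf_ennreal_eq)
      show "0 \<le> Re (cinner y (M (B i) y))" for i
      proof -
        interpret positive_form "M (B i)" using B by (intro povm_positive_form) auto
        show ?thesis using q_nonneg[of y] by (simp add: q_def)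
      qed
      show "(\<lambda>i. Re (cinner y (M (B i) y))) sums Re (cinner y (M (\<Union>i. B i) y))"
        by (rule sums_Re[OF add[OF B]])
    qed
    then show "(\<Sum>i. \<Sum>j. ennreal (Re (cinner (x j) (M (B i) (x j)))))
       = (\<Sum>j. ennreal (Re (cinner (x j) (M (\<Union>i. B i) (x j)))))"
      by (subst suminf_ennreal_swap) simp
  qed
qed

lemma emeasure_ensemble_law_circle:
  "emeasure (ensemble_law M x) circle = (\<Sum>j. ennreal ((norm (x j))\<^sup>2))"
proof -
  have "M circle = id" using povm by (simp add: povm_on_circle_def)
  then show ?thesis by (simp add: emeasure_ensemble_law cinner_self flip: of_real_power)
qed

text \<open>Transfers the measure property to the law given by the Born rule: agreement of the two
  set functions on the \<sigma>-algebra makes the measures equal.\<close>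

lemma outcome_law_eq_ensemble_law:
  fixes e :: "nat \<Rightarrow> 'h"
  assumes basis: "orthonormal_basis e"
    and \<rho>: "positive_operator \<rho>"
    and \<psi>: "\<And>j n. n < j \<Longrightarrow> cinner (\<psi> j) (e n) = 0"
      "\<And>n. \<rho> (e n) = (\<Sum>j\<le>n. cinner (\<psi> j) (e n) *\<^sub>C \<psi> j)"
    and summable: "summable (\<lambda>j. (norm (\<psi> j))\<^sup>2)"
  shows "outcome_law e (phase_shifted e \<rho> \<theta>) M = ensemble_law M (\<lambda>j. phase_op e \<theta> (\<psi> j))"
  unfolding outcome_law_def ensemble_law_def
proof (rule measure_of_eq[OF circle_sets_subset])
  fix B assume "B \<in> sigma_sets circle circle_sets"
  then have B: "B \<in> circle_sets"
    using sigma_algebra.sigma_sets_eq[OF sigma_algebra_circle] by simp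
  interpret positive_form "M B" using B by (rule povm_positive_form)
  have "positive_operator (M B)" using povm B unfolding povm_on_circle_def by blast
  then have "(\<lambda>j. q (phase_op e \<theta> (\<psi> j))) sums Re (op_trace e (phase_shifted e \<rho> \<theta> \<circ> M B))"
    unfolding q_def using sums_op_trace_phase_shifted[OF basis \<rho> \<psi> summable] by blast
  then have "(\<Sum>j. ennreal (q (phase_op e \<theta> (\<psi> j)))) = ennreal (Re (op_trace e (phase_shifted e \<rho> \<theta> \<circ> M B)))"
    by (intro suminf_ennreal_eq) auto
  then show "ennreal (Re (op_trace e (phase_shifted e \<rho> \<theta> \<circ> M B)))
    = (\<Sum>j. ennreal (Re (cinner (phase_op e \<theta> (\<psi> j)) (M B (phase_op e \<theta> (\<psi> j))))))"
    by (simp add: q_def)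
qed

end

text \<open>The filter \<open>x\<close> replaces each amplitude \<open>\<langle>n|\<phi>\<rangle>\<close> by \<open>x n * \<langle>n|\<phi>\<rangle>\<close>. What it removes is bounded
  trivially, and what it keeps is compared by Cauchy-Schwarz with the mixture of number states
  of weights \<open>s n\<close>, whose outcome law does not see the phase.\<close>

lemma ensemble_law_filter_le:
  fixes e :: "nat \<Rightarrow> 'h::complex_hilbert_space"
  assumes povm: "povm_on_circle M" and B: "B \<in> circle_sets" and c: "c \<ge> 0"
    and s: "\<And>n. n < K \<Longrightarrow> s n > 0"
    and \<eta>: "\<And>j. \<eta> j = (\<Sum>n<K. (of_real (x n) * cinner (e n) (\<phi> j)) *\<^sub>C e n)"
    and p: "\<And>n. (\<Sum>j. ennreal ((cmod (cinner (e n) (\<phi> j)))\<^sup>2)) = ennreal (p n)" "\<And>n. p n \<ge> 0"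
  defines "\<nu> \<equiv> ensemble_law M (\<lambda>n. if n < K then of_real (sqrt (s n)) *\<^sub>C e n else 0)"
  shows "ennreal (c / (1 + c)) * emeasure (ensemble_law M \<phi>) B
    \<le> emeasure (ensemble_law M (\<lambda>j. \<phi> j - \<eta> j)) B
      + ennreal c * (ennreal (\<Sum>n<K. (x n)\<^sup>2 * p n / s n) * emeasure \<nu> B)"
proof -
  interpret positive_form "M B" using povm B by (rule povm_positive_form)
  \<comment> \<open>\<open>D j\<close> is the Cauchy-Schwarz factor of the j-th component, and
    \<open>T\<close> is the value of the number-state law at \<open>B\<close>, common to all
    components.\<close>
  define D where "D j = (\<Sum>n<K. (x n)\<^sup>2 * (cmod (cinner (e n) (\<phi> j)))\<^sup>2 / s n)" for j
  define T where "T = (\<Sum>n<K. s n * q (e n))"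
  have s0: "s n \<ge> 0" if "n < K" for n using s[OF that] by simp
  have T: "T \<ge> 0" unfolding T_def using s0 by (intro sum_nonneg mult_nonneg_nonneg) auto
  have D: "D j \<ge> 0" for j unfolding D_def using s0 by (intro sum_nonneg divide_nonneg_nonneg mult_nonneg_nonneg) auto
  have \<nu>: "emeasure \<nu> B = ennreal T"
  proof -
    have "emeasure \<nu> B = (\<Sum>n. ennreal (q (if n < K then of_real (sqrt (s n)) *\<^sub>C e n else 0)))"
      unfolding \<nu>_def emeasure_ensemble_law[OF povm B] q_def ..
    also have "\<dots> = (\<Sum>n<K. ennreal (s n * q (e n)))"
      using s0 by (subst suminf_finite[of "{..<K}"]) (auto simp: q_scaleC)
    also have "\<dots> = ennreal T"
      unfolding T_def using s0 by (intro sum_ennreal mult_nonneg_nonneg) auto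
    finally show ?thesis .
  qed
  have m: "ennreal ((x n)\<^sup>2 * a / s n) = ennreal ((x n)\<^sup>2 / s n) * ennreal a" if "n < K" "a \<ge> 0" for n a
    using s0 that by (subst ennreal_mult[symmetric]) auto
  have D_sum: "(\<Sum>j. ennreal (D j)) = ennreal (\<Sum>n<K. (x n)\<^sup>2 * p n / s n)"
  proof -
    have "ennreal (D j) = (\<Sum>n<K. ennreal ((x n)\<^sup>2 * (cmod (cinner (e n) (\<phi> j)))\<^sup>2 / s n))" for j
      unfolding D_def using s0 by (intro sum_ennreal[symmetric] divide_nonneg_nonneg mult_nonneg_nonneg) auto
    moreover have "(\<Sum>n<K. ennreal ((x n)\<^sup>2 * (cmod (cinner (e n) (\<phi> j)))\<^sup>2 / s n)) = (\<Sum>n<K. ennreal ((x n)\<^sup>2 / s n) * ennreal ((cmod (cinner (e n) (\<phi> j)))\<^sup>2))" for j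
      by (intro sum.cong refl m) auto
    ultimately have "(\<Sum>j. ennreal (D j)) = (\<Sum>n<K. \<Sum>j. ennreal ((x n)\<^sup>2 / s n) * ennreal ((cmod (cinner (e n) (\<phi> j)))\<^sup>2))"
      by (simp only: suminf_sum[OF summableI])
    also have "\<dots> = (\<Sum>n<K. ennreal ((x n)\<^sup>2 / s n) * ennreal (p n))"
      unfolding ennreal_suminf_cmult p(1) ..
    also have "(\<Sum>n<K. ennreal ((x n)\<^sup>2 / s n) * ennreal (p n)) = (\<Sum>n<K. ennreal ((x n)\<^sup>2 * p n / s n))"
      using p(2) by (intro sum.cong refl m[symmetric]) auto
    also have "\<dots> = ennreal (\<Sum>n<K. (x n)\<^sup>2 * p n / s n)"
      using s0 p(2) by (intro sum_ennreal divide_nonneg_nonneg mult_nonneg_nonneg) auto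
    finally show ?thesis .
  qed
  have pt: "c / (1 + c) * q (\<phi> j) \<le> q (\<phi> j - \<eta> j) + c * (D j * T)" for j
  proof -
    have "q (\<eta> j) \<le> (\<Sum>n<K. (cmod (of_real (x n) * cinner (e n) (\<phi> j)))\<^sup>2 / s n) * T"
      unfolding \<eta> T_def using s by (intro q_sum_le) auto
    then have "q (\<eta> j) \<le> D j * T"
      by (simp add: D_def norm_mult power_mult_distrib)
    then have "c * q (\<eta> j) \<le> c * (D j * T)" using c by (rule mult_left_mono)
    then show ?thesis using q_filter[OF c, of "\<phi> j" "\<eta> j"] by linarith
  qed
  have "ennreal (c / (1 + c)) * emeasure (ensemble_law M \<phi>) B = (\<Sum>j. ennreal (c / (1 + c)) * ennreal (q (\<phi> j)))"
    unfolding emeasure_ensemble_law[OF povm B] q_def by simp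
  also have "\<dots> \<le> (\<Sum>j. ennreal (q (\<phi> j - \<eta> j)) + ennreal c * (ennreal (D j) * ennreal T))"
  proof (intro suminf_le summableI)
    fix j
    have "ennreal (c / (1 + c)) * ennreal (q (\<phi> j)) = ennreal (c / (1 + c) * q (\<phi> j))"
      using c by (intro ennreal_mult[symmetric]) auto
    also have "\<dots> \<le> ennreal (q (\<phi> j - \<eta> j) + c * (D j * T))"
      by (rule ennreal_leI[OF pt])
    also have "\<dots> = ennreal (q (\<phi> j - \<eta> j)) + ennreal c * (ennreal (D j) * ennreal T)"
      using c D T by (simp add: ennreal_mult)
    finally show "ennreal (c / (1 + c)) * ennreal (q (\<phi> j))
      \<le> ennreal (q (\<phi> j - \<eta> j)) + ennreal c * (ennreal (D j) * ennreal T)" .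
  qed
  also have "\<dots> = (\<Sum>j. ennreal (q (\<phi> j - \<eta> j))) + ennreal c * ((\<Sum>j. ennreal (D j)) * ennreal T)"
    by (subst suminf_add[OF summableI summableI, symmetric]) simp
  also have "\<dots> = emeasure (ensemble_law M (\<lambda>j. \<phi> j - \<eta> j)) B
      + ennreal c * (ennreal (\<Sum>n<K. (x n)\<^sup>2 * p n / s n) * emeasure \<nu> B)"
    unfolding emeasure_ensemble_law[OF povm B, of "\<lambda>j. \<phi> j - \<eta> j"] q_def[symmetric] \<nu> D_sum ..
  finally show ?thesis .
qed


text \<open>Besides the mean square error, only the integral of the bump against the law of the number
  states depends on \<open>\<theta>\<close>, and that one is controlled by averaging over \<open>\<theta>\<close>.\<close>

lemma mean_square_error_filter:
  fixes e :: "nat \<Rightarrow> 'h::complex_hilbert_space"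
  assumes basis: "orthonormal_basis e" and povm: "povm_on_circle M" and r: "r > 0"
    and s: "\<And>n. n < K \<Longrightarrow> s n > 0" and x: "\<And>n. n \<ge> K \<Longrightarrow> x n = 0"
    and \<phi>: "(\<lambda>j. (norm (\<phi> j))\<^sup>2) sums 1"
    and p: "\<And>n. (\<Sum>j. ennreal ((cmod (cinner (e n) (\<phi> j)))\<^sup>2)) = ennreal (p n)" "\<And>n. p n \<ge> 0"
  shows "ennreal (r\<^sup>2) \<le> (\<integral>\<^sup>+z. ennreal ((reduce_angle (Arg z - \<theta>))\<^sup>2) \<partial>ensemble_law M \<phi>)
    + ennreal (5/4 * r\<^sup>2) * ((\<Sum>n. ennreal ((1 - x n)\<^sup>2 * p n)) + ennreal (\<Sum>n<K. (x n)\<^sup>2 * p n / s n) *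
       (\<integral>\<^sup>+z. ennreal (bump (reduce_angle (Arg z - \<theta>) / r))
          \<partial>ensemble_law M (\<lambda>n. if n < K then of_real (sqrt (s n)) *\<^sub>C e n else 0)))"
proof -
  define \<eta> where "\<eta> j = (\<Sum>n<K. (of_real (x n) * cinner (e n) (\<phi> j)) *\<^sub>C e n)" for j
  define \<nu> where "\<nu> = ensemble_law M (\<lambda>n. if n < K then of_real (sqrt (s n)) *\<^sub>C e n else 0)"
  define Q where "Q = (\<Sum>n<K. (x n)\<^sup>2 * p n / s n)"
  define v where "v z = bump (reduce_angle (Arg z - \<theta>) / r)" for z
  let ?law = "ensemble_law M \<phi>" and ?rest = "ensemble_law M (\<lambda>j. \<phi> j - \<eta> j)"
  have v0: "v z \<ge> 0" for z by (simp add: v_def)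
  have meas_borel [measurable]: "v \<in> borel_measurable borel" unfolding v_def[abs_def] by measurable
  have meas: "f \<in> borel_measurable ?law" if "f \<in> borel_measurable borel" for f :: "complex \<Rightarrow> ennreal"
    using that by (rule borel_measurable_ensemble_law)
  \<comment> \<open>Since \<open>x\<close> vanishes from \<open>K\<close> on, \<eta> has the
    coefficients \<open>x n\<close> times those of \<phi> at every \<open>n\<close>, also beyond the
    finite sum.\<close>
  have rest: "emeasure ?rest circle = (\<Sum>n. ennreal ((1 - x n)\<^sup>2 * p n))"
  proof -
    have "cinner (e n) (\<eta> j) = of_real (x n) * cinner (e n) (\<phi> j)" for n j
      using x[of n]
      by (cases "n < K") (auto simp: \<eta>_def cinner_sum_right cinner_scaleC_right cinner_basis[OF basis] if_distrib cong: if_cong)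
    then have "cinner (e n) (\<phi> j - \<eta> j) = of_real (1 - x n) * cinner (e n) (\<phi> j)" for n j
      by (simp add: cinner_diff_right left_diff_distrib)
    then have coeff: "(cmod (cinner (e n) (\<phi> j - \<eta> j)))\<^sup>2 = (1 - x n)\<^sup>2 * (cmod (cinner (e n) (\<phi> j)))\<^sup>2" for n j
      by (simp add: norm_mult power_mult_distrib del: of_real_diff)
    have "ennreal ((norm (\<phi> j - \<eta> j))\<^sup>2) = (\<Sum>n. ennreal ((cmod (cinner (e n) (\<phi> j - \<eta> j)))\<^sup>2))" for j
      by (rule suminf_ennreal_eq[symmetric, OF _ basis_norm_sums[OF basis]]) simp
    then have "ennreal ((norm (\<phi> j - \<eta> j))\<^sup>2) = (\<Sum>n. ennreal ((1 - x n)\<^sup>2) * ennreal ((cmod (cinner (e n) (\<phi> j)))\<^sup>2))" for j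
      unfolding coeff by (simp only: ennreal_mult zero_le_power2)
    then have "(\<Sum>j. ennreal ((norm (\<phi> j - \<eta> j))\<^sup>2)) = (\<Sum>n. ennreal ((1 - x n)\<^sup>2) * ennreal (p n))"
      by (simp only:) (subst suminf_ennreal_swap, simp only: ennreal_suminf_cmult p(1))
    then show ?thesis
      unfolding emeasure_ensemble_law_circle[OF povm] using p(2) by (simp only: ennreal_mult zero_le_power2)
  qed
  have total: "emeasure ?law circle = 1"
    unfolding emeasure_ensemble_law_circle[OF povm] using \<phi> by (subst suminf_ennreal_eq[of _ 1]) auto
  have "(\<integral>\<^sup>+z. ennreal (v z / (1 + v z)) \<partial>?law)
     \<le> emeasure ?rest (space ?rest) + (\<integral>\<^sup>+z. ennreal (v z) \<partial>scale_measure (ennreal Q) \<nu>)"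
  proof (rule nn_integral_filter_le)
    show "v \<in> borel_measurable ?law" using meas_borel by (rule borel_measurable_ensemble_law)
    fix B c assume "B \<in> sets ?law" "(c::real) \<ge> 0"
    then show "ennreal (c / (1 + c)) * emeasure ?law B
      \<le> emeasure ?rest B + ennreal c * emeasure (scale_measure (ennreal Q) \<nu>) B"
      using ensemble_law_filter_le[OF povm, of B c K s \<eta> x e \<phi> p] s p
      by (simp add: \<eta>_def \<nu>_def Q_def)
  qed (auto simp: v0 \<nu>_def)
  also have "\<dots> = (\<Sum>n. ennreal ((1 - x n)\<^sup>2 * p n)) + ennreal Q * (\<integral>\<^sup>+z. ennreal (v z) \<partial>\<nu>)"
    using rest by (simp add: nn_integral_scale_measure \<nu>_def borel_measurable_ensemble_law)
  finally have window: "(\<integral>\<^sup>+z. ennreal (v z / (1 + v z)) \<partial>?law)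
     \<le> (\<Sum>n. ennreal ((1 - x n)\<^sup>2 * p n)) + ennreal Q * (\<integral>\<^sup>+z. ennreal (v z) \<partial>\<nu>)" .
  have "ennreal (r\<^sup>2) = (\<integral>\<^sup>+z. ennreal (r\<^sup>2) \<partial>?law)" using total by simp
  also have "\<dots> \<le> (\<integral>\<^sup>+z. ennreal ((reduce_angle (Arg z - \<theta>))\<^sup>2) + ennreal (5/4 * r\<^sup>2) * ennreal (v z / (1 + v z)) \<partial>?law)"
  proof (rule nn_integral_mono)
    fix z
    define \<delta> where "\<delta> = reduce_angle (Arg z - \<theta>)"
    \<comment> \<open>The truncated parabola was chosen for this: rescaled by
      \<open>5/4 * r^2\<close> it dominates \<open>r^2 - \<delta>^2\<close>, so few small errors
      mean a large mean square.\<close>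
    have "5/4 * r\<^sup>2 * (4/5 * (1 - (\<delta> / r)\<^sup>2)) \<le> 5/4 * r\<^sup>2 * (v z / (1 + v z))"
      unfolding v_def \<delta>_def[symmetric] by (intro mult_left_mono bump_filter_ge) simp
    moreover have "5/4 * r\<^sup>2 * (4/5 * (1 - (\<delta> / r)\<^sup>2)) = r\<^sup>2 - \<delta>\<^sup>2"
      using r by (simp add: power_divide right_diff_distrib)
    ultimately have "r\<^sup>2 \<le> \<delta>\<^sup>2 + 5/4 * r\<^sup>2 * (v z / (1 + v z))" by linarith
    then have "ennreal (r\<^sup>2) \<le> ennreal (\<delta>\<^sup>2 + 5/4 * r\<^sup>2 * (v z / (1 + v z)))" by (rule ennreal_leI)
    also have "\<dots> = ennreal (\<delta>\<^sup>2) + ennreal (5/4 * r\<^sup>2 * (v z / (1 + v z)))"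
      using v0[of z] by (intro ennreal_plus) auto
    also have "ennreal (5/4 * r\<^sup>2 * (v z / (1 + v z))) = ennreal (5/4 * r\<^sup>2) * ennreal (v z / (1 + v z))"
      using v0[of z] by (intro ennreal_mult) auto
    finally show "ennreal (r\<^sup>2) \<le> ennreal ((reduce_angle (Arg z - \<theta>))\<^sup>2) + ennreal (5/4 * r\<^sup>2) * ennreal (v z / (1 + v z))"
      unfolding \<delta>_def .
  qed
  also have "\<dots> = (\<integral>\<^sup>+z. ennreal ((reduce_angle (Arg z - \<theta>))\<^sup>2) \<partial>?law)
      + ennreal (5/4 * r\<^sup>2) * (\<integral>\<^sup>+z. ennreal (v z / (1 + v z)) \<partial>?law)"
  proof -
    have m: "(\<lambda>z. ennreal ((reduce_angle (Arg z - \<theta>))\<^sup>2)) \<in> borel_measurable borel"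
      "(\<lambda>z. ennreal (v z / (1 + v z))) \<in> borel_measurable borel"
      "(\<lambda>z. ennreal (5/4 * r\<^sup>2) * ennreal (v z / (1 + v z))) \<in> borel_measurable borel"
      by measurable
    show ?thesis
      unfolding nn_integral_add[OF meas[OF m(1)] meas[OF m(3)]] nn_integral_cmult[OF meas[OF m(2)]] ..
  qed
  also have "\<dots> \<le> (\<integral>\<^sup>+z. ennreal ((reduce_angle (Arg z - \<theta>))\<^sup>2) \<partial>?law)
      + ennreal (5/4 * r\<^sup>2) * ((\<Sum>n. ennreal ((1 - x n)\<^sup>2 * p n)) + ennreal Q * (\<integral>\<^sup>+z. ennreal (v z) \<partial>\<nu>))"
    by (intro add_left_mono mult_left_mono window) simp
  finally show ?thesis unfolding Q_def \<nu>_def v_def .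
qed

text \<open>The midpoint rule underestimates the integral of the convex function
  \<open>m * (max 0 t)^(m - 1)\<close> over the unit interval around \<open>y\<close>, for m = 2, 3,
  4.\<close>

lemma midpoint_power_le:
  fixes y :: real
  defines "a \<equiv> max 0 (y + 1/2)" and "b \<equiv> max 0 (y - 1/2)" and "c \<equiv> max 0 y"
  shows "2 * c \<le> a^2 - b^2" "3 * c^2 \<le> a^3 - b^3" "4 * c^3 \<le> a^4 - b^4"
proof -
  consider "y \<ge> 1/2" | "0 \<le> y" "y \<le> 1/2" | "y \<le> 0" by linarith
  then have "2 * c \<le> a^2 - b^2 \<and> 3 * c^2 \<le> a^3 - b^3 \<and> 4 * c^3 \<le> a^4 - b^4"
  proof cases
    case 1
    then have abc: "a = y + 1/2" "b = y - 1/2" "c = y" by (auto simp: a_def b_def c_def)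
    have "(y + 1/2)^2 - (y - 1/2)^2 = 2 * y" "(y + 1/2)^3 - (y - 1/2)^3 = 3 * y^2 + 1/4"
      "(y + 1/2)^4 - (y - 1/2)^4 = 4 * y^3 + y" by algebra+
    then show ?thesis using 1 by (simp only: abc) simp
  next
    case 2
    then have abc: "a = y + 1/2" "b = 0" "c = y" by (auto simp: a_def b_def c_def)
    have "0 \<le> (y - 1/2)^2" by simp
    then have a2: "2 * y \<le> a^2" by (simp add: abc power2_eq_square algebra_simps)
    have y2: "y * y \<le> 1 * y" using 2 by (intro mult_right_mono) auto
    have "3 * y^2 \<le> 2 * y * a" using y2 2 by (simp add: abc power2_eq_square algebra_simps)
    also have "\<dots> \<le> a^2 * a" using a2 2 by (intro mult_right_mono) (auto simp: abc)
    finally have a3: "3 * y^2 \<le> a^3" by (simp add: power2_eq_square power3_eq_cube)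
    have "y * y * y \<le> y * y * 1" using 2 by (intro mult_left_mono) auto
    then have "4 * y^3 \<le> (2 * y)^2" by (simp add: power2_eq_square power3_eq_cube)
    also have "\<dots> \<le> (a^2)^2" using a2 2 by (intro power_mono) auto
    finally have "4 * y^3 \<le> a^4" by simp
    then show ?thesis using a2 a3 by (simp add: abc(2,3))
  next
    case 3
    then have "b = 0" "c = 0" "a \<ge> 0" by (auto simp: a_def b_def c_def)
    then show ?thesis by simp
  qed
  then show "2 * c \<le> a^2 - b^2" "3 * c^2 \<le> a^3 - b^3" "4 * c^3 \<le> a^4 - b^4" by auto
qed

text \<open>The unit intervals around the midpoints are adjacent, so the upper bounds telescope to
  \<open>k^m\<close>.\<close>

lemma sum_midpoint_power_le:
  fixes k :: real
  assumes "k \<ge> 0"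
  defines "z \<equiv> \<lambda>n. max 0 (k - (real n + 1/2))"
  shows "(\<Sum>n<K. z n) \<le> k^2 / 2" "(\<Sum>n<K. (z n)^2) \<le> k^3 / 3" "(\<Sum>n<K. (z n)^3) \<le> k^4 / 4"
proof -
  define Z where "Z n = max 0 (k - real n)" for n
  have tele: "(\<Sum>n<K. (Z n)^m - (Z (Suc n))^m) \<le> k^m" for m
  proof -
    have "(\<Sum>n<K. (Z n)^m - (Z (Suc n))^m) = (Z 0)^m - (Z K)^m" by (rule sum_lessThan_telescope')
    also have "\<dots> \<le> k^m" using assms by (simp add: Z_def)
    finally show ?thesis .
  qed
  have "2 * z n \<le> (Z n)^2 - (Z (Suc n))^2" "3 * (z n)^2 \<le> (Z n)^3 - (Z (Suc n))^3"
    "4 * (z n)^3 \<le> (Z n)^4 - (Z (Suc n))^4" for n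
    using midpoint_power_le[of "k - (real n + 1/2)"] by (simp_all add: z_def Z_def algebra_simps)
  then have "(\<Sum>n<K. 2 * z n) \<le> k^2" "(\<Sum>n<K. 3 * (z n)^2) \<le> k^3" "(\<Sum>n<K. 4 * (z n)^3) \<le> k^4"
    by (intro order_trans[OF sum_mono tele]; simp)+
  then show "(\<Sum>n<K. z n) \<le> k^2 / 2" "(\<Sum>n<K. (z n)^2) \<le> k^3 / 3" "(\<Sum>n<K. (z n)^3) \<le> k^4 / 4"
    by (simp_all add: sum_distrib_left[symmetric])
qed

text \<open>For \<open>t \<le> 1/2\<close> the cubic majorant of \<open>t / (1 - t)\<close> reduces
  the sum to the three power sums, with total 1/4 + 1/12 + 1/16 = 19/48 times
  \<open>k\<close>.\<close>

lemma sum_filter_weights_le: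
  fixes k :: real
  assumes k: "k > 0"
  defines "x \<equiv> \<lambda>n. max 0 (k - (real n + 1/2)) / (2 * k)"
  shows "(\<Sum>n<K. x n / (1 - x n)) \<le> 2/5 * k"
proof -
  define z where "z n = max 0 (k - (real n + 1/2))" for n
  have "t / (1 - t) \<le> t + t^2 + 2 * t^3" if "0 \<le> t" "t \<le> 1/2" for t :: real
  proof -
    have "0 \<le> t * (t\<^sup>2 * (1 - 2 * t))" using that by (intro mult_nonneg_nonneg) auto
    also have "\<dots> = (t + t^2 + 2 * t^3) * (1 - t) - t" by algebra
    finally show ?thesis using that by (simp add: pos_divide_le_eq)
  qed
  moreover have "0 \<le> x n" "x n \<le> 1/2" for n
    using k by (auto simp: x_def max_def field_simps)
  ultimately have "(\<Sum>n<K. x n / (1 - x n)) \<le> (\<Sum>n<K. x n + (x n)^2 + 2 * (x n)^3)"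
    by (intro sum_mono) auto
  also have "\<dots> = (\<Sum>n<K. z n) / (2 * k) + (\<Sum>n<K. (z n)^2) / (2 * k)^2 + 2 * ((\<Sum>n<K. (z n)^3) / (2 * k)^3)"
    by (simp add: x_def z_def sum.distrib sum_divide_distrib sum_distrib_left power_divide)
  also have "\<dots> \<le> (k^2 / 2) / (2 * k) + (k^3 / 3) / (2 * k)^2 + 2 * ((k^4 / 4) / (2 * k)^3)"
    unfolding z_def using k by (intro add_mono mult_left_mono divide_right_mono sum_midpoint_power_le) auto
  also have "\<dots> = 19/48 * k" using k by (simp add: eval_nat_numeral)
  also have "\<dots> \<le> 2/5 * k" using k by simp
  finally show ?thesis .
qed


section \<open>The error bound\<close>

lemma bayes_cost_ge:
  fixes e :: "nat \<Rightarrow> 'h::complex_hilbert_space"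
  assumes basis: "orthonormal_basis e" and \<rho>: "density_operator e \<rho>"
    and I: "is_interval I" "emeasure lborel I = ennreal L" "0 < L" "L \<le> 2 * pi"
    and povm: "povm_on_circle M"
    and N: "mean_number e \<rho> = ennreal N" "N \<ge> 0"
  defines "r \<equiv> L / (18/5 * (N + 1/2))"
  shows "ennreal (r\<^sup>2 * L / 8) \<le> (\<integral>\<^sup>+\<theta>\<in>I. (\<integral>\<^sup>+z. ennreal ((reduce_angle (Arg z - \<theta>))\<^sup>2)
      \<partial>outcome_law e (phase_shifted e \<rho> \<theta>) M) \<partial>lborel)"
proof -
  \<comment> \<open>\<open>k = 5 * u / 2\<close> maximises the resulting bound among filters decreasing linearly from \<open>1/2\<close>; then
    \<open>r\<close> is as large as the normalisation of the weights \<open>s\<close> permits.\<close>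
  define u k where "u = N + 1/2" and "k = 5/2 * u"
  have u: "u > 0" and k: "k > 0" using N(2) by (auto simp: u_def k_def)
  have r: "r > 0" "r * (18/5) = L / u" using I(3) u by (auto simp: r_def u_def[symmetric])
  define x where "x = (\<lambda>n. max 0 (k - (real n + 1/2)) / (2 * k))"
  \<comment> \<open>The number of indices with \<open>x n > 0\<close>, so that every weight
    \<open>s n\<close> used as a divisor is positive.\<close>
  define K where "K = nat \<lceil>k - 1/2\<rceil>"
  \<comment> \<open>This makes \<open>x^2 / (s * u) = x * (1 - x)\<close>, which together with
    \<open>(1 - x)^2\<close> gives \<open>1 - x\<close>.\<close>
  define s where "s = (\<lambda>n. 1 / u * (x n / (1 - x n)))"
  have x: "0 \<le> x n" "x n \<le> 1/2" for n
    using k by (auto simp: x_def max_def field_simps)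
  have K: "n < K \<longleftrightarrow> real n + 1/2 < k" for n
    unfolding K_def zless_nat_eq_int_zless less_ceiling_iff by auto
  have xK: "x n > 0" if "n < K" for n using that k by (simp add: K x_def)
  have xK0: "x n = 0" if "n \<ge> K" for n using that K[of n] by (simp add: x_def)
  have s: "s n > 0" if "n < K" for n
    using xK[OF that] x[of n] u by (simp add: s_def)
  have s_sum: "(\<Sum>n<K. s n) \<le> 1"
  proof -
    have "(\<Sum>n<K. s n) = 1 / u * (\<Sum>n<K. x n / (1 - x n))"
      unfolding s_def sum_distrib_left ..
    also have "\<dots> \<le> 1 / u * (2/5 * k)"
      unfolding x_def using u k by (intro mult_left_mono sum_filter_weights_le) auto
    also have "\<dots> = 1" using u by (simp add: k_def)
    finally show ?thesis .
  qed

  have pos\<rho>: "positive_operator \<rho>" using \<rho> by (simp add: density_operator_def)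
  interpret positive_form \<rho> using pos\<rho> by (rule positive_form_positive_operator)
  define p where "p n = q (e n)" for n
  have p0: "p n \<ge> 0" for n by (simp add: p_def)
  obtain \<psi> where \<psi>: "\<And>j n. n < j \<Longrightarrow> cinner (\<psi> j) (e n) = 0"
      "\<And>n. \<rho> (e n) = (\<Sum>j\<le>n. cinner (\<psi> j) (e n) *\<^sub>C \<psi> j)"
    and p_sum': "\<And>n. ennreal (Re (cinner (e n) (\<rho> (e n)))) = (\<Sum>j. ennreal ((cmod (cinner (e n) (\<psi> j)))\<^sup>2))"
    and norm_\<psi>: "(\<lambda>j. (norm (\<psi> j))\<^sup>2) sums 1"
    using density_operator_cholesky[OF basis \<rho>] by blast
  have p_sum: "ennreal (p n) = (\<Sum>j. ennreal ((cmod (cinner (e n) (\<psi> j)))\<^sup>2))" for n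
    unfolding p_def q_def by (rule p_sum')
  have "(\<Sum>n. ennreal (p n)) = 1"
  proof -
    have "(\<Sum>n. ennreal (p n)) = (\<Sum>j. \<Sum>n. ennreal ((cmod (cinner (e n) (\<psi> j)))\<^sup>2))"
      unfolding p_sum by (rule suminf_ennreal_swap)
    also have "\<dots> = (\<Sum>j. ennreal ((norm (\<psi> j))\<^sup>2))"
      by (intro arg_cong[of _ _ suminf] ext suminf_ennreal_eq[OF _ basis_norm_sums[OF basis]]) simp
    also have "\<dots> = 1" by (subst suminf_ennreal_eq[OF _ norm_\<psi>]) simp_all
    finally show ?thesis .
  qed
  moreover have "(\<Sum>n. ennreal (real n * p n)) = ennreal N"
  proof -
    have "Re (cinner (e n) (\<rho> (number_op e (e n)))) = real n * p n" for n
      by (simp add: number_op_basis[OF basis] scale cinner_scaleC_right cinner_q p_def)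
    then show ?thesis using N(1) by (simp add: mean_number_def)
  qed
  ultimately have p_sums: "p sums 1" "(\<lambda>n. real n * p n) sums N"
    using p0 N(2) by (auto intro!: suminf_ennreal_imp_sums)

  define Q where "Q = (\<Sum>n<K. (x n)\<^sup>2 * p n / s n)"
  have Q0: "Q \<ge> 0" unfolding Q_def using s p0 by (intro sum_nonneg divide_nonneg_nonneg mult_nonneg_nonneg) (auto intro: less_imp_le)
  define N1 where "N1 = (\<Sum>n. (1 - x n)\<^sup>2 * p n)"
  have budget: "N1 + Q / u \<le> 7/10" and N1: "(\<Sum>n. ennreal ((1 - x n)\<^sup>2 * p n)) = ennreal N1" "N1 \<ge> 0"
  proof -
    have bound: "(\<lambda>n. (1/2 + 1 / (4 * k)) * p n + 1 / (2 * k) * (real n * p n)) sums ((1/2 + 1 / (4 * k)) * 1 + 1 / (2 * k) * N)"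
      by (intro sums_add sums_mult p_sums)
    have le: "(1 - x n) * p n \<le> (1/2 + 1 / (4 * k)) * p n + 1 / (2 * k) * (real n * p n)" for n
    proof -
      have "(k - (real n + 1/2)) / (2 * k) \<le> x n"
        unfolding x_def using k by (intro divide_right_mono) auto
      moreover have "(k - (real n + 1/2)) / (2 * k) = 1 - (1/2 + 1 / (4 * k) + 1 / (2 * k) * real n)"
        using k by (simp add: field_simps)
      ultimately have "1 - x n \<le> 1/2 + 1 / (4 * k) + 1 / (2 * k) * real n" by linarith
      from mult_right_mono[OF this p0[of n]] show ?thesis by (simp add: algebra_simps)
    qed
    have sq: "(1 - x n)\<^sup>2 * p n \<le> (1 - x n) * p n" for n
      unfolding power2_eq_square using x[of n] p0[of n] by (intro mult_right_mono mult_left_le_one_le) auto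
    have summ1: "summable (\<lambda>n. (1 - x n) * p n)"
      using le x p0 by (intro summable_comparison_test'[OF sums_summable[OF bound], of 0]) (simp add: order_trans[OF x(2)])
    have summ2: "summable (\<lambda>n. (1 - x n)\<^sup>2 * p n)"
      using sq p0 by (intro summable_comparison_test'[OF summ1, of 0]) simp
    show "N1 \<ge> 0" unfolding N1_def using p0 by (intro suminf_nonneg[OF summ2]) simp
    show "(\<Sum>n. ennreal ((1 - x n)\<^sup>2 * p n)) = ennreal N1"
      unfolding N1_def using p0 by (intro suminf_ennreal2 summ2) simp
    have "(x n)\<^sup>2 * p n / s n / u = x n * (1 - x n) * p n" if "n < K" for n
      using xK[OF that] x[of n] u by (simp add: s_def power2_eq_square)
    then have "Q / u = (\<Sum>n<K. x n * (1 - x n) * p n)"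
      unfolding Q_def sum_divide_distrib by (intro sum.cong) auto
    then have "(\<lambda>n. x n * (1 - x n) * p n) sums (Q / u)"
      using sums_finite[of "{..<K}" "\<lambda>n. x n * (1 - x n) * p n"] xK0 by simp
    moreover have "(\<lambda>n. (1 - x n)\<^sup>2 * p n) sums N1"
      unfolding N1_def using summ2 by (rule summable_sums)
    ultimately have "(\<lambda>n. (1 - x n)\<^sup>2 * p n + x n * (1 - x n) * p n) sums (N1 + Q / u)"
      by (intro sums_add)
    moreover have "(1 - x n)\<^sup>2 * p n + x n * (1 - x n) * p n = (1 - x n) * p n" for n
      by (simp add: power2_eq_square algebra_simps)
    ultimately have "N1 + Q / u \<le> (1/2 + 1 / (4 * k)) * 1 + 1 / (2 * k) * N"
      using le by (intro sums_le[OF _ _ bound]) auto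
    also have "\<dots> = 1/2 + u / (2 * k)" by (simp add: u_def add_divide_distrib)
    also have "\<dots> = 7/10" using u by (simp add: k_def)
    finally show "N1 + Q / u \<le> 7/10" .
  qed

  define \<nu> where "\<nu> = ensemble_law M (\<lambda>n. if n < K then of_real (sqrt (s n)) *\<^sub>C e n else 0)"
  have \<nu>_le: "emeasure \<nu> (space \<nu>) \<le> 1"
  proof -
    have "emeasure \<nu> (space \<nu>) = (\<Sum>n. ennreal ((norm (if n < K then of_real (sqrt (s n)) *\<^sub>C e n else 0))\<^sup>2))"
      unfolding \<nu>_def space_ensemble_law emeasure_ensemble_law_circle[OF povm] ..
    also have "\<dots> = (\<Sum>n<K. ennreal (s n))"
      using s by (subst suminf_finite[of "{..<K}"]) (auto simp: norm_scaleC norm_basis[OF basis] less_imp_le)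
    also have "\<dots> = ennreal (\<Sum>n<K. s n)" using s by (intro sum_ennreal) (auto intro: less_imp_le)
    also have "\<dots> \<le> 1" using s_sum by simp
    finally show ?thesis .
  qed
  define V where "V \<theta> = (\<integral>\<^sup>+z. ennreal (bump (reduce_angle (Arg z - \<theta>) / r)) \<partial>\<nu>)" for \<theta>
  define cost where "cost \<theta> = (\<integral>\<^sup>+z. ennreal ((reduce_angle (Arg z - \<theta>))\<^sup>2) \<partial>outcome_law e (phase_shifted e \<rho> \<theta>) M)" for \<theta>
  define R where "R \<theta> = ennreal (5/4 * r\<^sup>2) * (ennreal N1 + ennreal Q * V \<theta>)" for \<theta>
  have cost: "ennreal (r\<^sup>2) \<le> cost \<theta> + R \<theta>" for \<theta>
  proof -
    \<comment> \<open>A phase shift changes only the arguments of the coefficients, so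
      \<open>p\<close>, \<open>Q\<close> and \<open>N1\<close> do not depend on \<theta>.\<close>
    have "cmod (cinner (e n) (phase_op e \<theta> (\<psi> j))) = cmod (cinner (e n) (\<psi> j))" for n j
      by (simp add: cinner_basis_phase_op[OF basis] norm_mult norm_exp_eq_Re)
    then have "(\<Sum>j. ennreal ((cmod (cinner (e n) (phase_op e \<theta> (\<psi> j))))\<^sup>2)) = ennreal (p n)" for n
      by (simp add: p_sum)
    moreover have "(\<lambda>j. (norm (phase_op e \<theta> (\<psi> j)))\<^sup>2) sums 1"
      using norm_\<psi> by (simp add: norm_phase_op[OF basis])
    moreover have "outcome_law e (phase_shifted e \<rho> \<theta>) M = ensemble_law M (\<lambda>j. phase_op e \<theta> (\<psi> j))"
      by (rule outcome_law_eq_ensemble_law[OF povm basis pos\<rho> \<psi> sums_summable[OF norm_\<psi>]])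
    ultimately show ?thesis
      using mean_square_error_filter[OF basis povm r(1), of K s x "\<lambda>j. phase_op e \<theta> (\<psi> j)" p \<theta>] s xK0 p0
      unfolding cost_def R_def V_def \<nu>_def Q_def N1(1) by simp
  qed

  interpret \<nu>: finite_measure \<nu>
    using \<nu>_le by (intro finite_measureI) (auto simp: top_unique)
  interpret pair_sigma_finite lborel \<nu> ..
  have I_sets [measurable]: "I \<in> sets borel" using I(1) by (rule real_interval_borel_measurable)
  have joint: "(\<lambda>(\<theta>, z). ennreal (bump (reduce_angle (Arg z - \<theta>) / r)) * indicator I \<theta>) \<in> borel_measurable (lborel \<Otimes>\<^sub>M \<nu>)"
  proof -
    have [measurable]: "Arg \<in> borel_measurable \<nu>"
      unfolding \<nu>_def by (rule borel_measurable_ensemble_law) measurable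
    show ?thesis by measurable
  qed
  have V_int: "(\<integral>\<^sup>+\<theta>. V \<theta> * indicator I \<theta> \<partial>lborel) \<le> ennreal (L / u)"
  proof -
    have "(\<integral>\<^sup>+\<theta>. V \<theta> * indicator I \<theta> \<partial>lborel)
      = (\<integral>\<^sup>+\<theta>. \<integral>\<^sup>+z. ennreal (bump (reduce_angle (Arg z - \<theta>) / r)) * indicator I \<theta> \<partial>\<nu> \<partial>lborel)"
      unfolding V_def by (intro nn_integral_cong nn_integral_multc[symmetric])
        (auto simp: \<nu>_def intro!: borel_measurable_ensemble_law)
    \<comment> \<open>After Fubini the outcome \<open>z\<close> is fixed and the bump is integrated
      over the phase, which gives a bound independent of \<open>z\<close> and of the POVM.\<close>
    also have "\<dots> = (\<integral>\<^sup>+z. \<integral>\<^sup>+\<theta>. ennreal (bump (reduce_angle (Arg z - \<theta>) / r)) * indicator I \<theta> \<partial>lborel \<partial>\<nu>)"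
      by (rule Fubini'[OF joint, symmetric])
    also have "\<dots> \<le> (\<integral>\<^sup>+z. ennreal (r * (18/5)) \<partial>\<nu>)"
    proof (rule nn_integral_mono)
      fix z
      have "(\<integral>\<^sup>+\<theta>. ennreal (bump (reduce_angle (Arg z - \<theta>) / r)) * indicator I \<theta> \<partial>lborel)
        \<le> (\<integral>\<^sup>+y. ennreal (bump (y / r)) \<partial>lborel)"
        by (rule nn_integral_interval_reduce_angle_le[where f = "\<lambda>y. ennreal (bump (y / r))"]) (use I in auto)
      also have "\<dots> \<le> ennreal (r * (18/5))" by (rule nn_integral_bump_scaled[OF r(1)])
      finally show "(\<integral>\<^sup>+\<theta>. ennreal (bump (reduce_angle (Arg z - \<theta>) / r)) * indicator I \<theta> \<partial>lborel) \<le> ennreal (r * (18/5))" .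
    qed
    also have "\<dots> \<le> ennreal (r * (18/5)) * 1"
      unfolding nn_integral_const by (intro mult_left_mono \<nu>_le) simp
    finally show ?thesis unfolding r(2) by simp
  qed
  have V_meas [measurable]: "V \<in> borel_measurable borel"
  proof -
    have [measurable]: "Arg \<in> borel_measurable \<nu>"
      unfolding \<nu>_def by (rule borel_measurable_ensemble_law) measurable
    have "V \<in> borel_measurable lborel"
      unfolding V_def[abs_def] by (rule \<nu>.borel_measurable_nn_integral) measurable
    then show ?thesis by simp
  qed
  have R_meas [measurable]: "R \<in> borel_measurable borel"
    unfolding R_def[abs_def] by measurable
  have L_int: "(\<integral>\<^sup>+\<theta>. c * indicator I \<theta> \<partial>lborel) = c * ennreal L" for c
    using I(2) by (simp add: nn_integral_cmult_indicator)
  have R_int: "(\<integral>\<^sup>+\<theta>. R \<theta> * indicator I \<theta> \<partial>lborel) \<le> ennreal (7/8 * (r\<^sup>2 * L))"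
  proof -
    have "(\<integral>\<^sup>+\<theta>. R \<theta> * indicator I \<theta> \<partial>lborel)
      = (\<integral>\<^sup>+\<theta>. ennreal (5/4 * r\<^sup>2) * (ennreal N1 * indicator I \<theta> + ennreal Q * (V \<theta> * indicator I \<theta>)) \<partial>lborel)"
      unfolding R_def by (intro nn_integral_cong) (simp add: algebra_simps)
    also have "\<dots> = ennreal (5/4 * r\<^sup>2) * (ennreal N1 * ennreal L + ennreal Q * (\<integral>\<^sup>+\<theta>. V \<theta> * indicator I \<theta> \<partial>lborel))"
      by (simp add: nn_integral_cmult nn_integral_add L_int)
    also have "\<dots> \<le> ennreal (5/4 * r\<^sup>2) * (ennreal N1 * ennreal L + ennreal Q * ennreal (L / u))"
      by (intro mult_left_mono add_left_mono V_int) auto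
    also have "\<dots> = ennreal (5/4 * r\<^sup>2 * (N1 * L + Q * (L / u)))"
    proof -
      have nn: "0 \<le> N1 * L" "0 \<le> Q * (L / u)" "0 \<le> L" "0 \<le> L / u" "0 \<le> 5/4 * r\<^sup>2"
        using N1(2) Q0 I(3) u by auto
      show ?thesis
        unfolding ennreal_mult[OF N1(2) nn(3), symmetric] ennreal_mult[OF Q0 nn(4), symmetric]
          ennreal_plus[OF nn(1,2), symmetric] ennreal_mult[OF nn(5) add_nonneg_nonneg[OF nn(1,2)], symmetric] ..
    qed
    also have "\<dots> \<le> ennreal (7/8 * (r\<^sup>2 * L))"
    proof (rule ennreal_leI)
      have "5/4 * r\<^sup>2 * (N1 * L + Q * (L / u)) = 5/4 * r\<^sup>2 * L * (N1 + Q / u)"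
        by (simp add: algebra_simps)
      also have "\<dots> \<le> 5/4 * r\<^sup>2 * L * (7/10)"
        using I(3) by (intro mult_left_mono budget) auto
      finally show "5/4 * r\<^sup>2 * (N1 * L + Q * (L / u)) \<le> 7/8 * (r\<^sup>2 * L)" by (simp add: mult.commute[of L])
    qed
    finally show ?thesis .
  qed
  \<comment> \<open>A measurable minorant of \<open>cost\<close>: the integral is split on
    \<open>h + R\<close>, and \<open>cost\<close> itself enters only through monotonicity.\<close>
  define h where "h \<theta> = ennreal (r\<^sup>2) - R \<theta>" for \<theta>
  have [measurable]: "h \<in> borel_measurable borel" unfolding h_def[abs_def] by measurable
  have h_le: "h \<theta> \<le> cost \<theta>" for \<theta>
    using cost[of \<theta>] unfolding h_def by (simp add: ennreal_minus_le_iff add.commute)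
  have h_ge: "ennreal (r\<^sup>2) \<le> h \<theta> + R \<theta>" for \<theta>
    unfolding h_def by (cases "R \<theta> \<le> ennreal (r\<^sup>2)") (simp_all add: diff_add_cancel_ennreal add_increasing)
  define C where "C = (\<integral>\<^sup>+\<theta>. cost \<theta> * indicator I \<theta> \<partial>lborel)"
  have "ennreal (r\<^sup>2 * L) = (\<integral>\<^sup>+\<theta>. ennreal (r\<^sup>2) * indicator I \<theta> \<partial>lborel)"
    unfolding L_int using I(3) by (simp add: ennreal_mult)
  also have "\<dots> \<le> (\<integral>\<^sup>+\<theta>. h \<theta> * indicator I \<theta> + R \<theta> * indicator I \<theta> \<partial>lborel)"
    using h_ge by (intro nn_integral_mono) (auto simp: indicator_def)
  also have "\<dots> = (\<integral>\<^sup>+\<theta>. h \<theta> * indicator I \<theta> \<partial>lborel) + (\<integral>\<^sup>+\<theta>. R \<theta> * indicator I \<theta> \<partial>lborel)"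
    by (rule nn_integral_add) measurable
  also have "\<dots> \<le> C + ennreal (7/8 * (r\<^sup>2 * L))"
    unfolding C_def using h_le by (intro add_mono R_int nn_integral_mono mult_right_mono) auto
  finally have "ennreal (r\<^sup>2 * L) \<le> C + ennreal (7/8 * (r\<^sup>2 * L))" .
  then have "ennreal (r\<^sup>2 * L / 8) \<le> C"
  proof (cases C)
    case (real c)
    then have "r\<^sup>2 * L \<le> c + 7/8 * (r\<^sup>2 * L)"
      using \<open>ennreal (r\<^sup>2 * L) \<le> C + _\<close> I(3) by (simp add: ennreal_plus[symmetric] del: ennreal_plus)
    then show ?thesis using real by (simp add: ennreal_leI)
  qed simp
  then show ?thesis unfolding C_def cost_def .
qed

text \<open>Gives the finiteness of the mean square error that the theorem needs to evaluate
  \<open>rmse\<close>.\<close>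

lemma emeasure_outcome_law_space:
  fixes e :: "nat \<Rightarrow> 'h::complex_hilbert_space"
  assumes basis: "orthonormal_basis e" and \<rho>: "density_operator e \<rho>" and povm: "povm_on_circle M"
  shows "emeasure (outcome_law e (phase_shifted e \<rho> \<theta>) M) (space (outcome_law e (phase_shifted e \<rho> \<theta>) M)) = 1"
proof -
  have pos: "positive_operator \<rho>" using \<rho> by (simp add: density_operator_def)
  obtain \<psi> where \<psi>: "\<And>j n. n < j \<Longrightarrow> cinner (\<psi> j) (e n) = 0"
      "\<And>n. \<rho> (e n) = (\<Sum>j\<le>n. cinner (\<psi> j) (e n) *\<^sub>C \<psi> j)"
    and "\<And>n. ennreal (Re (cinner (e n) (\<rho> (e n)))) = (\<Sum>j. ennreal ((cmod (cinner (e n) (\<psi> j)))\<^sup>2))"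
    and norm: "(\<lambda>j. (norm (\<psi> j))\<^sup>2) sums 1"
    using density_operator_cholesky[OF basis \<rho>] by blast
  have "(\<Sum>j. ennreal ((norm (\<psi> j))\<^sup>2)) = 1"
    by (subst suminf_ennreal_eq[OF _ norm]) simp_all
  moreover have "outcome_law e (phase_shifted e \<rho> \<theta>) M = ensemble_law M (\<lambda>j. phase_op e \<theta> (\<psi> j))"
    by (rule outcome_law_eq_ensemble_law[OF povm basis pos \<psi> sums_summable[OF norm]])
  ultimately show ?thesis
    by (simp add: emeasure_ensemble_law_circle[OF povm] norm_phase_op[OF basis])
qed

theorem corollary4:
  fixes e :: "nat \<Rightarrow> 'h::complex_hilbert_space"
    and \<rho> :: "'h \<Rightarrow> 'h"
    and M :: "complex set \<Rightarrow> 'h \<Rightarrow> 'h"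
    and I :: "real set"
    and L :: real
  assumes "orthonormal_basis e"
    and "density_operator e \<rho>"
    and "is_interval I" and "emeasure lborel I = ennreal L"
    and "0 < L" and "L \<le> 2 * pi"
    and "povm_on_circle M"
  shows "((\<exists>\<alpha>\<ge>1/2. f_renyi \<alpha> = f_max) \<and> (\<forall>\<alpha>\<ge>1/2. f_renyi \<alpha> \<le> f_max) \<and>
          \<bar>f_max - 0.5823\<bar> < 0.00005) \<and>
         ennreal (rmse e \<rho> M I L) \<ge>
           ennreal (L / (2 * pi)) * (ennreal f_max / (mean_number e \<rho> + 1/2))"
proof (intro conjI)
  obtain \<alpha> where "\<alpha> \<ge> 1/2" "f_renyi \<alpha> = f_max" and fm: "0.5823 < f_max" "f_max < 0.58235"
    and "\<And>\<beta>. \<beta> \<ge> 1/2 \<Longrightarrow> f_renyi \<beta> \<le> f_max"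
    using f_max_attained by metis
  then show "\<exists>\<alpha>\<ge>1/2. f_renyi \<alpha> = f_max" "\<forall>\<alpha>\<ge>1/2. f_renyi \<alpha> \<le> f_max"
    by blast+
  show "\<bar>f_max - 0.5823\<bar> < 0.00005" using fm by simp
  define C where "C = (\<integral>\<^sup>+\<theta>\<in>I. (\<integral>\<^sup>+z. ennreal ((reduce_angle (Arg z - \<theta>))\<^sup>2)
      \<partial>outcome_law e (phase_shifted e \<rho> \<theta>) M) \<partial>lborel)"
  \<comment> \<open>\<open>enn2real\<close> sends infinity to 0, so a lower bound on the integral
    says something about \<open>rmse\<close> only once the integral is known to be finite.\<close>
  have C_finite: "C \<le> ennreal (pi\<^sup>2) * ennreal L"
  proof -
    have "(\<integral>\<^sup>+z. ennreal ((reduce_angle (Arg z - \<theta>))\<^sup>2) \<partial>outcome_law e (phase_shifted e \<rho> \<theta>) M) \<le> ennreal (pi\<^sup>2)" for \<theta>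
    proof -
      have "(reduce_angle t)\<^sup>2 \<le> pi\<^sup>2" for t
        using reduce_angle_bounds[of t] by (intro abs_le_square_iff[THEN iffD1]) simp
      then have "(\<integral>\<^sup>+z. ennreal ((reduce_angle (Arg z - \<theta>))\<^sup>2) \<partial>outcome_law e (phase_shifted e \<rho> \<theta>) M)
        \<le> (\<integral>\<^sup>+z. ennreal (pi\<^sup>2) \<partial>outcome_law e (phase_shifted e \<rho> \<theta>) M)"
        by (intro nn_integral_mono ennreal_leI)
      then show ?thesis
        unfolding nn_integral_const emeasure_outcome_law_space[OF assms(1,2,7)] by simp
    qed
    then have "C \<le> (\<integral>\<^sup>+\<theta>. ennreal (pi\<^sup>2) * indicator I \<theta> \<partial>lborel)"
      unfolding C_def by (intro nn_integral_mono mult_right_mono) auto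
    also have "\<dots> = ennreal (pi\<^sup>2) * ennreal L"
      using real_interval_borel_measurable[OF assms(3)] assms(4) by (simp add: nn_integral_cmult_indicator)
    finally show ?thesis .
  qed
  show "ennreal (L / (2 * pi)) * (ennreal f_max / (mean_number e \<rho> + 1/2)) \<le> ennreal (rmse e \<rho> M I L)"
  proof (cases "mean_number e \<rho>")
    \<comment> \<open>With an infinite mean photon number the claimed lower bound is 0.\<close>
    case top
    then show ?thesis by (simp add: ennreal_divide_top)
  next
    case (real N)
    define u where "u = N + 1/2"
    have u: "u > 0" using real by (simp add: u_def)
    define r where "r = L / (18/5 * u)"
    have r: "r > 0" using assms(5) u by (simp add: r_def)
    have "ennreal (r\<^sup>2 * L / 8) \<le> C"
      unfolding C_def r_def u_def by (rule bayes_cost_ge[OF assms(1-7)]) (use real in auto)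
    moreover obtain c where c: "C = ennreal c" "c \<ge> 0"
      using C_finite by (cases C) (auto simp: top_unique ennreal_mult_eq_top_iff)
    ultimately have "r\<^sup>2 * L / 8 \<le> c" by simp
    then have "r\<^sup>2 / 8 \<le> c / L" using assms(5) by (simp add: field_simps)
    \<comment> \<open>35/100 is a rational number just below \<open>1 / sqrt 8\<close>.\<close>
    moreover have "(r * (35/100))\<^sup>2 \<le> r\<^sup>2 / 8"
      by (simp add: power_mult_distrib power2_eq_square)
    ultimately have "r * (35/100) \<le> sqrt (c / L)"
      by (intro real_le_rsqrt) (rule order_trans)
    moreover have "rmse e \<rho> M I L = sqrt (c / L)"
      using c assms(5) unfolding rmse_def C_def[symmetric] by (simp add: divide_ennreal)
    ultimately have "r * (35/100) \<le> rmse e \<rho> M I L" by simp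
    moreover have "L / (2 * pi) * (f_max / u) \<le> r * (35/100)"
    proof -
      \<comment> \<open>\<open>pi > 3\<close> suffices, since \<open>0.58235 * 18/5\<close> is below
        2.1.\<close>
      have "f_max * (18/5) \<le> 35/100 * (2 * pi)" using fm(2) pi_gt3 by simp
      then have "f_max / (2 * pi) \<le> 35/100 / (18/5)" by (simp add: pos_divide_le_eq)
      then have "L / u * (f_max / (2 * pi)) \<le> L / u * (35/100 / (18/5))"
        using assms(5) u by (intro mult_left_mono) auto
      then show ?thesis by (simp add: r_def mult_ac)
    qed
    ultimately have "L / (2 * pi) * (f_max / u) \<le> rmse e \<rho> M I L" by linarith
    then have "ennreal (L / (2 * pi) * (f_max / u)) \<le> ennreal (rmse e \<rho> M I L)" by (rule ennreal_leI)
    moreover have "mean_number e \<rho> + 1/2 = ennreal u"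
    proof -
      have "(1/2 :: ennreal) = ennreal (1/2)" using divide_ennreal[of 1 2] by simp
      then show ?thesis using real by (simp add: u_def ennreal_plus)
    qed
    ultimately show ?thesis
      using fm(1) u assms(5) by (simp add: ennreal_mult[symmetric] divide_ennreal)
  qed
qed

end
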